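(* Consider the $N$-player constrained stochastic game $G^c_{ea}$ with independent state processes and average cost criterion described in the context. Let $\zeta=(v^i,u^i,x^i,\delta^i)_{i=1}^N$ with $v^i\in\mathbb{R}$, $u^i=(u^i(s^i))_{s^i\in S^i}$, $x^i=(x^i(s^i,a^i))_{(s^i,a^i)\in\mathcal{K}^i}$, $\delta^i=(\delta^i_k)_{k=1}^{n_i}$ real vectors, and let [MP3] be the problem of minimizing $$\psi(\zeta)=\sum_{i=1}^N\Big[\sum_{(s,a)\in\mathcal{K}}\Big(\prod_{j=1}^Nx^j(s^j,a^j)\Big)c^i(s,a)-\Big(v^i-\sum_{k=1}^{n_i}\delta^i_k\xi^i_k\Big)\Big]$$ over all $\zeta$ subject to (i) $v^i+u^i(s^i)\le\sum_{(s,a)^{-i}\in\mathcal{K}^{-i}}\Big(\prod_{j\ne i}x^j(s^j,a^j)\Big)c^i(s,a)+\sum_{k=1}^{n_i}\delta^i_k\Big[\sum_{(s,a)^{-i}\in\mathcal{K}^{-i}}\Big(\prod_{j\ne i}x^j(s^j,a^j)\Big)d^{i,k}(s,a)\Big]+\sum_{\bar s^i\in S^i}p^i(\bar s^i|s^i,a^i)u^i(\bar s^i)$ for all $s^i\in S^i$, $a^i\in A^i(s^i)$, $i=1,\dots,N$; (ii) $\sum_{(s^i,a^i)\in\mathcal{K}^i}(\delta(s^i,\bar s^i)-p^i(\bar s^i|s^i,a^i))x^i(s^i,a^i)=0$ for all $\bar s^i\in S^i$, $i=1,\dots,N$; (iii) $\sum_{(s^i,a^i)\in\mathcal{K}^i}x^i(s^i,a^i)=1$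 for all $i=1,\dots,N$; (iv) $\sum_{(s,a)\in\mathcal{K}}\Big(\prod_{j=1}^Nx^j(s^j,a^j)\Big)d^{i,k}(s,a)\le\xi^i_k$ for all $k=1,\dots,n_i$, $i=1,\dots,N$; (v) $x^i(s^i,a^i)\ge0$ for all $s^i\in S^i$, $a^i\in A^i(s^i)$, $i=1,\dots,N$; (vi) $\delta^i_k\ge0$ for all $k=1,\dots,n_i$, $i=1,\dots,N$. Then: (a) If $(f^{i*})_{i=1}^N$ is a (stationary) Nash equilibrium of $G^c_{ea}$, then there exists a vector $\zeta^*=(v^{i*},u^{i*},x^{i*},\delta^{i*})_{i=1}^N$ that is a global minimum of [MP3] with $\psi(\zeta^* )=0$. (b) If $\zeta^*=(v^{i*},u^{i*},x^{i*},\delta^{i*})_{i=1}^N$ is a global minimum of [MP3] with $\psi(\zeta^* )=0$, then $(f^{i*})_{i=1}^N$ is a Nash equilibrium of $G^c_{ea}$, where for all $s^i\in S^i$, $a^i\in A^i(s^i)$, $i=1,\dots,N$ $$f^{i*}(s^i,a^i)=\frac{x^{i*}(s^i,a^i)}{\sum_{b\in A^i(s^i)}x^{i*}(s^i,b)}$$ whenever the denominator is nonzero (when it is zero, $f^{i*}(s^i)$ is chosen arbitrarily from the probability measures on $A^i(s^i)$).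
   Context: Game data. For each player $i=1,\dots,N$: $S^i$ is a finite state space; $\gamma^i$ is a probability distribution on $S^i$ (the initial states of the players are independent; $\gamma=(\gamma^1,\dots,\gamma^N)$); $A^i(s^i)$ is the finite set of actions of player $i$ at $s^i\in S^i$; $\mathcal{K}^i=\{(s^i,a^i):s^i\in S^i,a^i\in A^i(s^i)\}$; $p^i(\cdot|s^i,a^i)$ is a probability measure on $S^i$ for each $(s^i,a^i)\in\mathcal{K}^i$ (each player controls his own Markov chain, independently of the others). Put $\mathcal{K}=\prod_{i=1}^N\mathcal{K}^i$, $\mathcal{K}^{-i}=\prod_{j\ne i}\mathcal{K}^j$; an element of $\mathcal{K}$ is written $(s,a)$ with $s=(s^1,\dots,s^N)$, $a=(a^1,\dots,a^N)$, and $(s,a)^{-i}\in\mathcal{K}^{-i}$ is the collection of its components $(s^j,a^j)$, $j\ne i$. Given are immediate costs $c^i:\mathcal{K}\to\mathbb{R}$, constraint costs $d^{i,k}:\mathcal{K}\to\mathbb{R}$ and bounds $\xi^i_k\in\mathbb{R}$, $k=1,\dots,n_i$. $\delta(\cdot,\cdot)$ with two state arguments is the Kronecker delta. Strategies. A history-dependent strategy of player $i$ assigns to each of his own histories $(s^i_0,a^i_0,\dots,s^i_{t-1},a^i_{t-1},s^i_t)$ a probability measure on $A^i(s^i_t)$; a player has no information about the states and actions of the other players. A stationary strategy of player $i$ is $f^i=(f^i(s^i,a^i))$ with $f^i(s^i)=f^i(s^i,\cdot)$ a probability measure on $A^i(s^i)$ for each $s^i\in S^i$, used at every time. A multi-strategy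 is a tuple $f=(f^1,\dots,f^N)$ of strategies; $f^{-i}$ is the tuple of the $f^j$, $j\ne i$, and $(f^{-i},g^i)$, also written $(g^i,f^{-i})$, is the multi-strategy in which player $i$ uses $g^i$ and each player $j\ne i$ uses $f^j$. With $\gamma$ and a multi-strategy $f$, let $\mathbb{E}^\gamma_f$ be the expectation for the induced process $\{X_t,\mathbb{A}_t\}_{t\ge0}$ of joint states and actions. Costs and constraints. $$C^i_{ea}(\gamma,f)=\limsup_{T\to\infty}\frac1T\sum_{t=0}^{T-1}\mathbb{E}^\gamma_f c^i(X_t,\mathbb{A}_t),\qquad D^{i,k}_{ea}(\gamma,f)=\limsup_{T\to\infty}\frac1T\sum_{t=0}^{T-1}\mathbb{E}^\gamma_f d^{i,k}(X_t,\mathbb{A}_t).$$ A multi-strategy $f$ is $i$-feasible if $D^{i,k}_{ea}(\gamma,f)\le\xi^i_k$ for all $k=1,\dots,n_i$, and feasible if it is $i$-feasible for every $i$. Nash equilibrium. A feasible stationary multi-strategy $f^*=(f^{1*},\dots,f^{N*})$ is a Nash equilibrium of $G^c_{ea}$ if for each player $i$ and every stationary $f^i$ such that $(f^i,f^{-i*})$ is $i$-feasible, $C^i_{ea}(\gamma,f^* )\le C^i_{ea}(\gamma,f^i,f^{-i*})$. Standing assumptions. The set of feasible stationary multi-strategies is nonempty. (A1) Ergodicity: for each player $i$ and for any stationary strategy $f^i$, the state process of player $i$ is an irreducible Markov chain with one ergodic class (and possibly some transient states). (A2) Strong Slater condition: every player $i$ has some strategy $g^i$ such that for any multi-strategy $f^{-i}$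 of the other players, $D^{i,k}_{ea}(\gamma,(f^{-i},g^i))<\xi^i_k$ for all $k=1,\dots,n_i$. (A3) The players do not observe their costs, i.e., the strategy chosen by any player does not depend on the realization of the costs. A global minimum of [MP3] means a feasible point at which $\psi$ is minimal over all feasible points. *)

theory Defs
  imports "HOL-Probability.Probability"
begin

text \<open>
  Players are the elements of a finite type \<open>'i\<close>. The state and action sets of all players live
  in common types \<open>'s\<close> and \<open>'a\<close>; values of the fields outside the sets given by \<open>states\<close> and
  \<open>acts\<close>, and of constraint data outside \<open>{1..num_con G i}\<close>, are irrelevant.
\<close>

record ('i, 's, 'a) csgame =
  states :: "'i \<Rightarrow> 's set"
  init :: "'i \<Rightarrow> 's pmf"
  acts :: "'i \<Rightarrow> 's \<Rightarrow> 'a set"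
  kernel :: "'i \<Rightarrow> 's \<Rightarrow> 'a \<Rightarrow> 's pmf"
  cost :: "'i \<Rightarrow> ('i \<Rightarrow> 's \<times> 'a) \<Rightarrow> real"
  num_con :: "'i \<Rightarrow> nat"
  con_cost :: "'i \<Rightarrow> nat \<Rightarrow> ('i \<Rightarrow> 's \<times> 'a) \<Rightarrow> real"
  con_bound :: "'i \<Rightarrow> nat \<Rightarrow> real"

definition game_data :: "('i, 's, 'a) csgame \<Rightarrow> bool" where
  "game_data G \<longleftrightarrow> (\<forall>i.
     finite (states G i) \<and> set_pmf (init G i) \<subseteq> states G i \<and>
     (\<forall>s\<in>states G i. finite (acts G i s) \<and> acts G i s \<noteq> {} \<and>
        (\<forall>a\<in>acts G i s. set_pmf (kernel G i s a) \<subseteq> states G i)))"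

definition pairs :: "('i, 's, 'a) csgame \<Rightarrow> 'i \<Rightarrow> ('s \<times> 'a) set" where
  "pairs G i = (SIGMA s:states G i. acts G i s)"

definition joint_pairs :: "('i, 's, 'a) csgame \<Rightarrow> ('i \<Rightarrow> 's \<times> 'a) set" where
  "joint_pairs G = (\<Pi>\<^sub>E j\<in>UNIV. pairs G j)"

definition other_pairs :: "('i, 's, 'a) csgame \<Rightarrow> 'i \<Rightarrow> ('i \<Rightarrow> 's \<times> 'a) set" where
  "other_pairs G i = (\<Pi>\<^sub>E j\<in>UNIV - {i}. pairs G j)"


section \<open>Strategies\<close>

text \<open>
  A history-dependent strategy maps the list of the player's own past state-action pairs, in
  chronological order, and his current state to a distribution of actions. Neither the other
  players' states and actions nor any realized costs are arguments, so no strategy can depend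
  on them.
\<close>

type_synonym ('s, 'a) strategy = "('s \<times> 'a) list \<Rightarrow> 's \<Rightarrow> 'a pmf"

definition is_strategy :: "('i, 's, 'a) csgame \<Rightarrow> 'i \<Rightarrow> ('s, 'a) strategy \<Rightarrow> bool" where
  "is_strategy G i g \<longleftrightarrow>
     (\<forall>h\<in>lists (pairs G i). \<forall>s\<in>states G i. set_pmf (g h s) \<subseteq> acts G i s)"

definition is_stationary :: "('i, 's, 'a) csgame \<Rightarrow> 'i \<Rightarrow> ('s \<Rightarrow> 'a pmf) \<Rightarrow> bool" where
  "is_stationary G i g \<longleftrightarrow> (\<forall>s\<in>states G i. set_pmf (g s) \<subseteq> acts G i s)"

definition stationary_multi :: "('i, 's, 'a) csgame \<Rightarrow> ('i \<Rightarrow> 's \<Rightarrow> 'a pmf) \<Rightarrow> bool" where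
  "stationary_multi G f \<longleftrightarrow> (\<forall>i. is_stationary G i (f i))"

definition use_always :: "('i \<Rightarrow> 's \<Rightarrow> 'a pmf) \<Rightarrow> 'i \<Rightarrow> ('s, 'a) strategy" where
  "use_always f = (\<lambda>i h s. f i s)"


section \<open>The induced process and the average costs\<close>

definition act_law ::
  "('i::finite \<Rightarrow> ('s, 'a) strategy) \<Rightarrow> ('i \<Rightarrow> 's \<times> 'a) list \<Rightarrow> ('i \<Rightarrow> 's) \<Rightarrow> ('i \<Rightarrow> 'a) pmf" where
  "act_law f h x = Pi_pmf UNIV undefined (\<lambda>i. f i (map (\<lambda>w. w i) h) (x i))"

text \<open>
  \<open>history_law G f t\<close> is the joint law of \<open>[(X\<^sub>0, A\<^sub>0), \<dots>, (X\<^bsub>t-1\<^esub>, A\<^bsub>t-1\<^esub>)]\<close> and \<open>X\<^sub>t\<close>.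
  These finite-dimensional laws determine all expectations that occur in the average costs.
\<close>

primrec history_law ::
  "('i::finite, 's, 'a) csgame \<Rightarrow> ('i \<Rightarrow> ('s, 'a) strategy) \<Rightarrow> nat
     \<Rightarrow> (('i \<Rightarrow> 's \<times> 'a) list \<times> ('i \<Rightarrow> 's)) pmf" where
  "history_law G f 0 = map_pmf (\<lambda>x. ([], x)) (Pi_pmf UNIV undefined (init G))"
| "history_law G f (Suc t) =
     bind_pmf (history_law G f t) (\<lambda>(h, x).
     bind_pmf (act_law f h x) (\<lambda>a.
     map_pmf (\<lambda>y. (h @ [\<lambda>i. (x i, a i)], y))
       (Pi_pmf UNIV undefined (\<lambda>i. kernel G i (x i) (a i)))))"

definition state_action_law ::
  "('i::finite, 's, 'a) csgame \<Rightarrow> ('i \<Rightarrow> ('s, 'a) strategy) \<Rightarrow> nat \<Rightarrow> ('i \<Rightarrow> 's \<times> 'a) pmf" where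
  "state_action_law G f t =
     bind_pmf (history_law G f t) (\<lambda>(h, x). map_pmf (\<lambda>a i. (x i, a i)) (act_law f h x))"

definition avg_cost ::
  "('i::finite, 's, 'a) csgame \<Rightarrow> (('i \<Rightarrow> 's \<times> 'a) \<Rightarrow> real) \<Rightarrow> ('i \<Rightarrow> ('s, 'a) strategy) \<Rightarrow> ereal"
where
  "avg_cost G r f = limsup (\<lambda>T. ereal
     (1 / real T * (\<Sum>t<T. measure_pmf.expectation (state_action_law G f t) r)))"

definition C_ea :: "('i::finite, 's, 'a) csgame \<Rightarrow> 'i \<Rightarrow> ('i \<Rightarrow> ('s, 'a) strategy) \<Rightarrow> ereal" where
  "C_ea G i f = avg_cost G (cost G i) f"

definition D_ea ::
  "('i::finite, 's, 'a) csgame \<Rightarrow> 'i \<Rightarrow> nat \<Rightarrow> ('i \<Rightarrow> ('s, 'a) strategy) \<Rightarrow> ereal" where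
  "D_ea G i k f = avg_cost G (con_cost G i k) f"

definition i_feasible :: "('i::finite, 's, 'a) csgame \<Rightarrow> 'i \<Rightarrow> ('i \<Rightarrow> ('s, 'a) strategy) \<Rightarrow> bool"
where
  "i_feasible G i f \<longleftrightarrow> (\<forall>k\<in>{1..num_con G i}. D_ea G i k f \<le> ereal (con_bound G i k))"

definition feasible :: "('i::finite, 's, 'a) csgame \<Rightarrow> ('i \<Rightarrow> ('s, 'a) strategy) \<Rightarrow> bool" where
  "feasible G f \<longleftrightarrow> (\<forall>i. i_feasible G i f)"

definition nash_equilibrium :: "('i::finite, 's, 'a) csgame \<Rightarrow> ('i \<Rightarrow> 's \<Rightarrow> 'a pmf) \<Rightarrow> bool" where
  "nash_equilibrium G f \<longleftrightarrow> stationary_multi G f \<and> feasible G (use_always f) \<and>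
     (\<forall>i g. is_stationary G i g \<and> i_feasible G i (use_always (f(i := g))) \<longrightarrow>
        C_ea G i (use_always f) \<le> C_ea G i (use_always (f(i := g))))"


section \<open>Ergodicity and the strong Slater condition\<close>

definition chain_step ::
  "('i, 's, 'a) csgame \<Rightarrow> 'i \<Rightarrow> ('s \<Rightarrow> 'a pmf) \<Rightarrow> ('s \<times> 's) set" where
  "chain_step G i g =
     {(s, s'). s \<in> states G i \<and> s' \<in> set_pmf (bind_pmf (g s) (\<lambda>a. kernel G i s a))}"

text \<open>
  An ergodic class is a closed communicating class that is aperiodic (positive recurrence being
  automatic for finite chains). Aperiodicity matters here: for periodic chains the time average
  of the joint cost depends on the relative phases of the players' chains and is not determined
  by the product of the individual stationary distributions.
\<close>

definition ergodic_class :: "('s \<times> 's) set \<Rightarrow> 's set \<Rightarrow> bool" where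
  "ergodic_class R C \<longleftrightarrow> C \<noteq> {} \<and> (\<forall>s\<in>C. R\<^sup>* `` {s} = C) \<and>
     (\<forall>s\<in>C. Gcd {m. 0 < m \<and> (s, s) \<in> R ^^ m} = (1::nat))"

definition transient_state :: "('s \<times> 's) set \<Rightarrow> 's \<Rightarrow> bool" where
  "transient_state R s \<longleftrightarrow> (\<exists>s'. (s, s') \<in> R\<^sup>* \<and> (s', s) \<notin> R\<^sup>*)"

definition ergodicity :: "('i, 's, 'a) csgame \<Rightarrow> bool" where
  "ergodicity G \<longleftrightarrow> (\<forall>i g. is_stationary G i g \<longrightarrow>
     (\<exists>C\<subseteq>states G i. ergodic_class (chain_step G i g) C \<and>
        (\<forall>s\<in>states G i - C. transient_state (chain_step G i g) s)))"

definition strong_slater :: "('i::finite, 's, 'a) csgame \<Rightarrow> bool" where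
  "strong_slater G \<longleftrightarrow> (\<forall>i. \<exists>g. is_strategy G i g \<and>
     (\<forall>f. (\<forall>j. j \<noteq> i \<longrightarrow> is_strategy G j (f j)) \<longrightarrow>
        (\<forall>k\<in>{1..num_con G i}. D_ea G i k (f(i := g)) < ereal (con_bound G i k))))"


section \<open>The mathematical program\<close>

record ('i, 's, 'a) mp_point =
  v_of :: "'i \<Rightarrow> real"
  u_of :: "'i \<Rightarrow> 's \<Rightarrow> real"
  x_of :: "'i \<Rightarrow> 's \<times> 'a \<Rightarrow> real"
  delta_of :: "'i \<Rightarrow> nat \<Rightarrow> real"

definition joint_sum ::
  "('i::finite, 's, 'a) csgame \<Rightarrow> ('i \<Rightarrow> 's \<times> 'a \<Rightarrow> real) \<Rightarrow> (('i \<Rightarrow> 's \<times> 'a) \<Rightarrow> real) \<Rightarrow> real" where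
  "joint_sum G x r = (\<Sum>w\<in>joint_pairs G. (\<Prod>j\<in>UNIV. x j (w j)) * r w)"

definition other_sum ::
  "('i::finite, 's, 'a) csgame \<Rightarrow> ('i \<Rightarrow> 's \<times> 'a \<Rightarrow> real) \<Rightarrow> 'i \<Rightarrow> (('i \<Rightarrow> 's \<times> 'a) \<Rightarrow> real)
     \<Rightarrow> 's \<times> 'a \<Rightarrow> real" where
  "other_sum G x i r sa =
     (\<Sum>w\<in>other_pairs G i. (\<Prod>j\<in>UNIV - {i}. x j (w j)) * r (w(i := sa)))"

definition psi :: "('i::finite, 's, 'a) csgame \<Rightarrow> ('i, 's, 'a) mp_point \<Rightarrow> real" where
  "psi G z = (\<Sum>i\<in>UNIV. joint_sum G (x_of z) (cost G i)
     - (v_of z i - (\<Sum>k = 1..num_con G i. delta_of z i k * con_bound G i k)))"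

definition mp3_feasible :: "('i::finite, 's, 'a) csgame \<Rightarrow> ('i, 's, 'a) mp_point \<Rightarrow> bool" where
  "mp3_feasible G z \<longleftrightarrow>
     (\<forall>i. \<forall>s\<in>states G i. \<forall>a\<in>acts G i s.
        v_of z i + u_of z i s \<le>
          other_sum G (x_of z) i (cost G i) (s, a)
          + (\<Sum>k = 1..num_con G i.
               delta_of z i k * other_sum G (x_of z) i (con_cost G i k) (s, a))
          + (\<Sum>s'\<in>states G i. pmf (kernel G i s a) s' * u_of z i s')) \<and>
     (\<forall>i. \<forall>s'\<in>states G i.
        (\<Sum>(s, a)\<in>pairs G i. (of_bool (s = s') - pmf (kernel G i s a) s') * x_of z i (s, a)) = 0) \<and>
     (\<forall>i. (\<Sum>(s, a)\<in>pairs G i. x_of z i (s, a)) = 1) \<and>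
     (\<forall>i. \<forall>k\<in>{1..num_con G i}. joint_sum G (x_of z) (con_cost G i k) \<le> con_bound G i k) \<and>
     (\<forall>i. \<forall>s\<in>states G i. \<forall>a\<in>acts G i s. x_of z i (s, a) \<ge> 0) \<and>
     (\<forall>i. \<forall>k\<in>{1..num_con G i}. delta_of z i k \<ge> 0)"

definition mp3_global_min :: "('i::finite, 's, 'a) csgame \<Rightarrow> ('i, 's, 'a) mp_point \<Rightarrow> bool" where
  "mp3_global_min G z \<longleftrightarrow> mp3_feasible G z \<and> (\<forall>z'. mp3_feasible G z' \<longrightarrow> psi G z \<le> psi G z')"

text \<open>
  The stationary multi-strategies read off from a point; where the normalizing sum vanishes, the
  action distribution is arbitrary.
\<close>

definition induced_multi ::
  "('i, 's, 'a) csgame \<Rightarrow> ('i, 's, 'a) mp_point \<Rightarrow> ('i \<Rightarrow> 's \<Rightarrow> 'a pmf) set" where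
  "induced_multi G z = {f. stationary_multi G f \<and>
     (\<forall>i. \<forall>s\<in>states G i. \<forall>a\<in>acts G i s. (\<Sum>b\<in>acts G i s. x_of z i (s, b)) \<noteq> 0 \<longrightarrow>
        pmf (f i s) a = x_of z i (s, a) / (\<Sum>b\<in>acts G i s. x_of z i (s, b)))}"

end

theory Submission
  imports Defs
begin

text \<open>
  Fix stationary strategies of all players but \<open>i\<close>. What player \<open>i\<close> can achieve against them
  depends on his strategy only through its long-run frequencies of state-action pairs, and both
  cost and constraints are linear in these frequencies. So a best response is an optimal solution
  of a linear program, whose dual variables are exactly the \<open>v\<close>, \<open>u\<close>, \<open>\<delta>\<close> of the mathematical
  program: the feasible points of the latter combine, for every player, a feasible \<open>x\<close> of his linear
  program with a feasible point of its dual (\<open>mp3_feasible_iff\<close>). Accordingly \<open>\<psi>\<close> is the sum over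
  the players of the duality gaps (\<open>psi_gaps\<close>). Weak duality makes each gap
  nonnegative, so \<open>\<psi> = 0\<close> forces every \<open>x\<^sup>i\<close> to be a best response; conversely, at an equilibrium
  strong duality provides multipliers that close all gaps at once.

  Three facts carry this argument.

  The players move independently, so at each time the law of the joint state-action pair is the
  product of the individual laws (\<open>state_action_law_product\<close>). Each individual law converges,
  because an aperiodic chain with a single ergodic class forgets its initial state at a geometric
  rate (\<open>converges\<close>). Hence the expected costs themselves converge, and the average cost is the
  multilinear function \<open>joint_sum\<close> of the individual frequencies (\<open>avg_cost_stationary\<close>).

  The frequencies of stationary strategies are all the probability vectors on the state-action
  pairs that satisfy flow balance. For normalizing such an \<open>x\<^sup>i\<close> at each state gives a strategy
  for which the state marginal of \<open>x\<^sup>i\<close> is invariant, and the invariant distribution is unique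
  (\<open>freq_of_reads_off\<close>). So deviations to stationary strategies and feasible points of the linear
  program correspond to each other (\<open>nash_iff_best_responses\<close>).

  Strong duality (\<open>strong_duality\<close>) comes from a Farkas lemma for linear functionals on a function
  space, applied to the program after homogenization.
\<close>

section \<open>A Farkas lemma for finitely many linear functionals\<close>

text \<open>
  One equation comprises additivity (\<open>c = 1\<close>) and homogeneity (\<open>x = 0\<close>).
\<close>

definition linear_form :: "(('v \<Rightarrow> real) \<Rightarrow> real) \<Rightarrow> bool" where
  "linear_form F \<longleftrightarrow> (\<forall>x y c. F (\<lambda>v. x v + c * y v) = F x + c * F y)"

lemma linear_form_add_scaled:
  "linear_form F \<Longrightarrow> F (\<lambda>v. x v + c * y v) = F x + c * F y"
  by (simp add: linear_form_def)

lemma linear_form_zero: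
  assumes "linear_form F"
  shows "F (\<lambda>v. 0) = 0"
  using linear_form_add_scaled[OF assms, of "\<lambda>v. 0" 1 "\<lambda>v. 0"] by simp

lemma linear_form_uminus:
  assumes "linear_form F"
  shows "F (\<lambda>v. - x v) = - F x"
  using linear_form_add_scaled[OF assms, of "\<lambda>v. 0" "-1" x] linear_form_zero[OF assms] by simp

text \<open>
  The indices in \<open>E\<close> stand for equality constraints, and their multipliers have no sign. The proof is
  by induction on the number of constraints. If the constraint \<open>\<alpha> m\<close> is needed
  for the conclusion, some \<open>x0\<close> satisfies all the others and has \<open>\<gamma> x0 > 0\<close>. Composing all
  functionals with the projection along \<open>x0\<close> onto the kernel of \<open>\<alpha> m\<close> removes that constraint; the
  induction hypothesis gives the old multipliers, and evaluation at \<open>x0\<close> the new one, with the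
  correct sign.
\<close>

lemma farkas:
  fixes \<alpha> :: "'j \<Rightarrow> ('v \<Rightarrow> real) \<Rightarrow> real"
  assumes "finite J" and "\<And>j. j \<in> J \<Longrightarrow> linear_form (\<alpha> j)" and "linear_form \<gamma>"
    and "\<And>x. (\<And>j. j \<in> J \<Longrightarrow> \<alpha> j x \<le> 0) \<Longrightarrow> (\<And>j. j \<in> J \<inter> E \<Longrightarrow> \<alpha> j x = 0) \<Longrightarrow> \<gamma> x \<le> 0"
  shows "\<exists>l. (\<forall>j\<in>J - E. 0 \<le> l j) \<and> (\<forall>x. \<gamma> x = (\<Sum>j\<in>J. l j * \<alpha> j x))"
  using assms
proof (induction J arbitrary: \<alpha> \<gamma> rule: finite_induct)
  case empty
  have "\<gamma> x = 0" for x
    using empty.prems(3)[of x] empty.prems(3)[of "\<lambda>v. - x v"]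
      linear_form_uminus[OF empty.prems(2), of x]
    by simp
  then show ?case by simp
next
  case (insert m J)
  show ?case
  proof (cases "\<forall>x. (\<forall>j\<in>J. \<alpha> j x \<le> 0) \<and> (\<forall>j\<in>J \<inter> E. \<alpha> j x = 0) \<longrightarrow> \<gamma> x \<le> 0")
    case True
    then obtain l where l: "\<forall>j\<in>J - E. 0 \<le> l j" "\<forall>x. \<gamma> x = (\<Sum>j\<in>J. l j * \<alpha> j x)"
      using insert.IH[of \<alpha> \<gamma>] insert.prems(1,2) by auto
    have "(\<Sum>j\<in>insert m J. (l(m := 0)) j * \<alpha> j x) = \<gamma> x" for x
    proof -
      have "(\<Sum>j\<in>J. (l(m := 0)) j * \<alpha> j x) = (\<Sum>j\<in>J. l j * \<alpha> j x)"
        using insert.hyps(2) by (intro sum.cong) auto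
      then show ?thesis using insert.hyps l(2) by simp
    qed
    then show ?thesis using l(1) by (intro exI[of _ "l(m := 0)"]) auto
  next
    case False
    then obtain x0 where x0: "\<And>j. j \<in> J \<Longrightarrow> \<alpha> j x0 \<le> 0" "\<And>j. j \<in> J \<inter> E \<Longrightarrow> \<alpha> j x0 = 0"
      "\<gamma> x0 > 0" by (auto simp: not_le)
    define b where "b = \<alpha> m x0"
    have b_pos: "b > 0" if "m \<notin> E"
      using insert.prems(3)[of x0] x0 that unfolding b_def by force
    have b_nz: "b \<noteq> 0"
      using insert.prems(3)[of x0] x0 unfolding b_def by force
    have lin_m: "linear_form (\<alpha> m)" using insert.prems(1) by simp
    define proj where "proj x = (\<lambda>v. x v + (- \<alpha> m x / b) * x0 v)" for x
    have shift: "F (proj x) = F x - \<alpha> m x / b * F x0" if "linear_form F" for F x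
      unfolding proj_def using linear_form_add_scaled[OF that, of x "- \<alpha> m x / b" x0] by simp
    have lin_proj: "linear_form (\<lambda>x. F (proj x))" if F: "linear_form F" for F
      unfolding shift[OF F] using b_nz
      by (simp add: linear_form_def linear_form_add_scaled[OF F] linear_form_add_scaled[OF lin_m]
          field_simps)
    have vanish: "\<alpha> m (proj x) = 0" for x
      using shift[OF lin_m, of x] b_nz by (simp add: b_def)
    have "\<exists>l. (\<forall>j\<in>J - E. 0 \<le> l j) \<and> (\<forall>x. \<gamma> (proj x) = (\<Sum>j\<in>J. l j * \<alpha> j (proj x)))"
    proof (rule insert.IH)
      show "linear_form (\<lambda>x. \<alpha> j (proj x))" if "j \<in> J" for j
        using insert.prems(1) that by (intro lin_proj) auto
      show "linear_form (\<lambda>x. \<gamma> (proj x))"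
        using insert.prems(2) by (rule lin_proj)
      show "\<gamma> (proj x) \<le> 0"
        if "\<And>j. j \<in> J \<Longrightarrow> \<alpha> j (proj x) \<le> 0" "\<And>j. j \<in> J \<inter> E \<Longrightarrow> \<alpha> j (proj x) = 0" for x
        using that vanish by (intro insert.prems(3)) force+
    qed
    then obtain l where l: "\<And>j. j \<in> J - E \<Longrightarrow> 0 \<le> l j"
      "\<And>x. \<gamma> (proj x) = (\<Sum>j\<in>J. l j * \<alpha> j (proj x))" by blast
    define lm where "lm = (\<gamma> x0 - (\<Sum>j\<in>J. l j * \<alpha> j x0)) / b"
    have "(\<Sum>j\<in>J. l j * \<alpha> j x0) \<le> 0"
    proof (rule sum_nonpos)
      show "l j * \<alpha> j x0 \<le> 0" if "j \<in> J" for j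
        using x0(1,2)[of j] l(1)[of j] that by (cases "j \<in> E") (auto simp: mult_nonneg_nonpos)
    qed
    then have lm_nonneg: "0 \<le> lm" if "m \<notin> E"
      using b_pos[OF that] x0(3) by (simp add: lm_def)
    have "\<gamma> x = (\<Sum>j\<in>J. l j * \<alpha> j x) + lm * \<alpha> m x" for x
    proof -
      have "\<gamma> x - \<alpha> m x / b * \<gamma> x0 = (\<Sum>j\<in>J. l j * (\<alpha> j x - \<alpha> m x / b * \<alpha> j x0))"
        using l(2)[of x] shift[OF insert.prems(2)] shift insert.prems(1) by simp
      also have "\<dots> = (\<Sum>j\<in>J. l j * \<alpha> j x) - \<alpha> m x / b * (\<Sum>j\<in>J. l j * \<alpha> j x0)"
        by (simp add: right_diff_distrib sum_subtractf sum_distrib_left mult.left_commute)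
      finally show ?thesis using b_nz by (simp add: lm_def field_simps)
    qed
    moreover have "(\<Sum>j\<in>J. (l(m := lm)) j * \<alpha> j x) = (\<Sum>j\<in>J. l j * \<alpha> j x)" for x
      using insert.hyps(2) by (intro sum.cong) auto
    ultimately have "\<gamma> x = (\<Sum>j\<in>insert m J. (l(m := lm)) j * \<alpha> j x)" for x
      using insert.hyps by simp
    then show ?thesis using l(1) lm_nonneg
      by (intro exI[of _ "l(m := lm)"]) auto
  qed
qed


section \<open>Averages and additive sets of naturals\<close>

lemma cesaro_limit:
  fixes a :: "nat \<Rightarrow> real"
  assumes "a \<longlonglongrightarrow> L"
  shows "(\<lambda>T. 1 / real T * (\<Sum>t<T. a t)) \<longlonglongrightarrow> L"
proof (rule LIMSEQ_I)
  fix e :: real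
  assume "e > 0"
  then obtain N where N: "\<And>t. t \<ge> N \<Longrightarrow> \<bar>a t - L\<bar> < e / 2"
    using LIMSEQ_D[OF assms, of "e / 2"] by (auto simp: real_norm_def)
  define K where "K = (\<Sum>t<N. \<bar>a t - L\<bar>)"
  obtain M :: nat where M: "real M > 2 * K / e" using reals_Archimedean2 by blast
  have "\<bar>1 / real T * (\<Sum>t<T. a t) - L\<bar> < e" if T: "T \<ge> max 1 (max M N)" for T
  proof -
    have "T > 0" using T by simp
    have "\<bar>(\<Sum>t<T. a t) - T * L\<bar> = \<bar>\<Sum>t<T. a t - L\<bar>" by (simp add: sum_subtractf)
    also have "\<dots> \<le> (\<Sum>t<T. \<bar>a t - L\<bar>)" by (rule sum_abs)
    also have "\<dots> = K + (\<Sum>t=N..<T. \<bar>a t - L\<bar>)"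
      unfolding K_def using T
      by (metis max.bounded_iff lessThan_atLeast0 sum.atLeastLessThan_concat zero_le)
    also have "(\<Sum>t=N..<T. \<bar>a t - L\<bar>) \<le> (\<Sum>t=N..<T. e / 2)"
      using N by (intro sum_mono) (simp add: less_imp_le)
    also have "\<dots> \<le> real T * (e / 2)"
      using \<open>e > 0\<close> by (simp add: mult_right_mono)
    finally have "\<bar>(\<Sum>t<T. a t) - T * L\<bar> \<le> K + real T * (e / 2)" by simp
    also have "K < real T * (e / 2)"
    proof -
      have "2 * K / e < real T" using M T by simp
      then show ?thesis using \<open>e > 0\<close> by (simp add: field_simps)
    qed
    finally have "\<bar>(\<Sum>t<T. a t) - T * L\<bar> < e * real T" by (simp add: mult.commute)
    then have "\<bar>((\<Sum>t<T. a t) - T * L) / real T\<bar> < e"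
      unfolding abs_divide using \<open>T > 0\<close> by (simp add: pos_divide_less_eq)
    moreover have "1 / real T * (\<Sum>t<T. a t) - L = ((\<Sum>t<T. a t) - T * L) / real T"
      using \<open>T > 0\<close> by (simp add: field_simps)
    ultimately show ?thesis by simp
  qed
  then show "\<exists>no. \<forall>n\<ge>no. norm (1 / real n * (\<Sum>t<n. a t) - L) < e"
    unfolding real_norm_def by blast
qed

text \<open>
  The return times to a state form such a set \<open>A\<close>, and aperiodicity is the condition on the \<open>Gcd\<close>.
  The smallest positive difference \<open>d\<close> of two members divides all members, since otherwise division
  with remainder would yield a smaller difference. So \<open>A\<close> contains consecutive numbers \<open>b\<close> and
  \<open>b + 1\<close>, whose nonnegative combinations exhaust everything from \<open>b * b\<close> on.
\<close>

lemma additive_Gcd_1_cofinite: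
  fixes A :: "nat set"
  assumes zero: "0 \<in> A" and add: "\<And>m n. m \<in> A \<Longrightarrow> n \<in> A \<Longrightarrow> m + n \<in> A"
    and gcd: "Gcd (A - {0}) = 1"
  shows "\<exists>N. \<forall>n\<ge>N. n \<in> A"
proof -
  have mult: "q * m \<in> A" if "m \<in> A" for q m
    by (induction q) (use zero add that in auto)
  have "A - {0} \<noteq> {}" using gcd by force
  then obtain g where g: "g \<in> A" "g > 0" by auto
  define d where "d = (LEAST d. d > 0 \<and> (\<exists>b\<in>A. b + d \<in> A))"
  have "\<exists>d>0. \<exists>b\<in>A. b + d \<in> A" using g zero by (intro exI[of _ g] conjI bexI[of _ 0]) auto
  then have d: "d > 0 \<and> (\<exists>b\<in>A. b + d \<in> A)"
    unfolding d_def by (rule LeastI_ex)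
  then obtain b where b: "b \<in> A" "b + d \<in> A" by blast
  have least: "d \<le> e" if "e > 0 \<and> (\<exists>b\<in>A. b + e \<in> A)" for e
    unfolding d_def using that by (rule Least_le)
  have "d dvd h" if "h \<in> A" for h
  proof (rule ccontr)
    assume "\<not> d dvd h"
    then have r: "0 < h mod d" by (simp add: mod_greater_zero_iff_not_dvd)
    have "(h div d) * (b + d) + h mod d = h + (h div d) * b"
      using div_mult_mod_eq[of h d] by (simp add: algebra_simps)
    moreover have "h + (h div d) * b \<in> A" using add mult that b by blast
    moreover have "(h div d) * (b + d) \<in> A" using mult b by blast
    ultimately have "\<exists>b\<in>A. b + h mod d \<in> A" by metis
    then have "d \<le> h mod d" using least r by blast
    then show False using d by (metis mod_less_divisor not_le)
  qed
  then have "d dvd Gcd (A - {0})" by (intro Gcd_greatest) auto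
  then have "d = 1" using gcd by simp
  have "n \<in> A" if n: "n \<ge> b * b" for n
  proof (cases "b = 0")
    case True
    then show ?thesis using mult[of 1 n] b \<open>d = 1\<close> by simp
  next
    case False
    have r: "n mod b < b" using False by simp
    have q: "b \<le> n div b" using n False by (simp add: less_eq_div_iff_mult_less_eq)
    have "n = (n div b - n mod b) * b + (n mod b) * (b + 1)"
    proof -
      have "(n div b - n mod b) * b + (n mod b) * (b + 1)
        = (n div b - n mod b + n mod b) * b + n mod b"
        by (simp only: algebra_simps)
      also have "n div b - n mod b + n mod b = n div b" using r q by simp
      finally show ?thesis by simp
    qed
    then show ?thesis using add mult b \<open>d = 1\<close> by metis
  qed
  then show ?thesis by blast
qed


section \<open>Convergence of finite chains with one aperiodic ergodic class\<close>

locale finite_chain =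
  fixes S :: "'s set" and Q :: "'s \<Rightarrow> 's pmf"
  assumes fin: "finite S" and closed: "\<And>s. s \<in> S \<Longrightarrow> set_pmf (Q s) \<subseteq> S"
begin

definition arcs :: "('s \<times> 's) set" where
  "arcs = {(s, s'). s \<in> S \<and> s' \<in> set_pmf (Q s)}"

primrec law :: "'s pmf \<Rightarrow> nat \<Rightarrow> 's pmf" where
  "law \<mu> 0 = \<mu>"
| "law \<mu> (Suc n) = bind_pmf (law \<mu> n) Q"

text \<open>
  \<open>push\<close> is one step of the chain on row vectors. It acts on signed vectors because differences of
  distributions are what contracts, in the \<open>\<ell>\<^sub>1\<close> norm \<open>mass\<close>.
\<close>

definition push :: "('s \<Rightarrow> real) \<Rightarrow> 's \<Rightarrow> real" where
  "push h s' = (\<Sum>s\<in>S. h s * pmf (Q s) s')"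

definition mass :: "('s \<Rightarrow> real) \<Rightarrow> real" where
  "mass h = (\<Sum>s\<in>S. \<bar>h s\<bar>)"

lemma set_law: "set_pmf \<mu> \<subseteq> S \<Longrightarrow> set_pmf (law \<mu> n) \<subseteq> S"
  using closed by (induction n) auto

lemma pmf_bind_on_S:
  assumes "set_pmf \<mu> \<subseteq> S"
  shows "pmf (bind_pmf \<mu> K) s' = (\<Sum>s\<in>S. pmf \<mu> s * pmf (K s) s')"
  unfolding pmf_bind using assms fin
  by (subst integral_measure_pmf_real[of S]) (auto simp: mult.commute)

lemma pmf_law_Suc:
  "set_pmf \<mu> \<subseteq> S \<Longrightarrow> pmf (law \<mu> (Suc n)) s' = push (pmf (law \<mu> n)) s'"
  using pmf_bind_on_S[OF set_law] by (simp add: push_def)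

lemma push_iterate:
  assumes "s' \<in> S"
  shows "(push ^^ n) h s' = (\<Sum>s\<in>S. h s * pmf (law (return_pmf s) n) s')"
  using assms
proof (induction n arbitrary: s')
  case 0
  have "h s * pmf (return_pmf s) s' = (if s = s' then h s else 0)" for s
    by (simp add: pmf_return)
  then show ?case using 0 fin by simp
next
  case (Suc n)
  have "(push ^^ Suc n) h s' =
      (\<Sum>z\<in>S. (\<Sum>s\<in>S. h s * pmf (law (return_pmf s) n) z) * pmf (Q z) s')"
    using Suc.IH by (simp add: push_def[of "(push ^^ n) h" s'])
  also have "\<dots> = (\<Sum>s\<in>S. h s * (\<Sum>z\<in>S. pmf (law (return_pmf s) n) z * pmf (Q z) s'))"
    by (simp only: sum_distrib_right sum_distrib_left mult.assoc) (rule sum.swap)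
  also have "\<dots> = (\<Sum>s\<in>S. h s * pmf (law (return_pmf s) (Suc n)) s')"
    by (intro sum.cong refl) (simp add: pmf_bind_on_S set_law)
  finally show ?case .
qed

text \<open>
  All rows of \<open>T\<close> put weight at least \<open>e\<close> on the same state \<open>z\<close>. That common part acts on \<open>h\<close> as
  \<open>e\<close> times the total of \<open>h\<close>, which is zero, and what remains of each row has weight \<open>1 - e\<close>.
\<close>

lemma kernel_contracts:
  assumes T: "\<And>s. s \<in> S \<Longrightarrow> set_pmf (T s) \<subseteq> S"
    and z: "z \<in> S" and e: "\<And>s. s \<in> S \<Longrightarrow> e \<le> pmf (T s) z"
    and h: "(\<Sum>s\<in>S. h s) = 0"
  shows "mass (\<lambda>s'. \<Sum>s\<in>S. h s * pmf (T s) s') \<le> (1 - e) * mass h"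
proof -
  define k where "k s s' = pmf (T s) s' - (if s' = z then e else 0)" for s s'
  have k_nonneg: "k s s' \<ge> 0" if "s \<in> S" for s s'
    using e[OF that] by (auto simp: k_def)
  have k_sum: "(\<Sum>s'\<in>S. k s s') = 1 - e" if "s \<in> S" for s
    using sum_pmf_eq_1[OF fin T[OF that]] z fin by (simp add: k_def sum_subtractf)
  have eq: "(\<Sum>s\<in>S. h s * pmf (T s) s') = (\<Sum>s\<in>S. h s * k s s')" for s'
    using h by (simp add: k_def right_diff_distrib sum_subtractf flip: sum_distrib_right)
  have "mass (\<lambda>s'. \<Sum>s\<in>S. h s * pmf (T s) s') \<le> (\<Sum>s'\<in>S. \<Sum>s\<in>S. \<bar>h s\<bar> * k s s')"
    unfolding mass_def eq
  proof (rule sum_mono)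
    fix s'
    have "\<bar>\<Sum>s\<in>S. h s * k s s'\<bar> \<le> (\<Sum>s\<in>S. \<bar>h s * k s s'\<bar>)" by (rule sum_abs)
    also have "\<dots> = (\<Sum>s\<in>S. \<bar>h s\<bar> * k s s')"
      using k_nonneg by (intro sum.cong) (auto simp: abs_mult)
    finally show "\<bar>\<Sum>s\<in>S. h s * k s s'\<bar> \<le> (\<Sum>s\<in>S. \<bar>h s\<bar> * k s s')" .
  qed
  also have "\<dots> = (\<Sum>s\<in>S. \<bar>h s\<bar> * (\<Sum>s'\<in>S. k s s'))"
    by (simp add: sum_distrib_left) (rule sum.swap)
  also have "\<dots> = (1 - e) * mass h"
    using k_sum by (simp add: mass_def mult.commute sum_distrib_left)
  finally show ?thesis .
qed

lemma sum_push: "(\<Sum>s\<in>S. push h s) = (\<Sum>s\<in>S. h s)"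
proof -
  have "(\<Sum>s'\<in>S. push h s') = (\<Sum>s\<in>S. h s * (\<Sum>s'\<in>S. pmf (Q s) s'))"
    unfolding push_def sum_distrib_left by (rule sum.swap)
  also have "\<dots> = (\<Sum>s\<in>S. h s)"
    using sum_pmf_eq_1[OF fin closed] by simp
  finally show ?thesis .
qed

lemma sum_push_iterate: "(\<Sum>s\<in>S. (push ^^ n) h s) = (\<Sum>s\<in>S. h s)"
  by (induction n) (simp_all add: sum_push)

lemma push_iterate_diff: "s \<in> S \<Longrightarrow> (push ^^ n) (\<lambda>s. h s - g s) s = (push ^^ n) h s - (push ^^ n) g s"
  by (simp add: push_iterate left_diff_distrib sum_subtractf)

lemma push_cong: "(\<And>s. s \<in> S \<Longrightarrow> h s = g s) \<Longrightarrow> push h = push g"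
  by (auto simp: push_def fun_eq_iff intro!: sum.cong)

lemma push_law: "set_pmf \<mu> \<subseteq> S \<Longrightarrow> (push ^^ n) (pmf (law \<mu> k)) = pmf (law \<mu> (n + k))"
proof (induction n)
  case (Suc n)
  have "(push ^^ Suc n) (pmf (law \<mu> k)) = push (pmf (law \<mu> (n + k)))" using Suc by simp
  also have "\<dots> = pmf (law \<mu> (Suc (n + k)))"
    by (rule ext) (rule pmf_law_Suc[OF Suc.prems, symmetric])
  finally show ?case by simp
qed simp

lemma abs_le_mass: "s \<in> S \<Longrightarrow> \<bar>h s\<bar> \<le> mass h"
  unfolding mass_def using fin by (intro member_le_sum) auto

lemma law_pos_of_relpow:
  "(s, s') \<in> arcs ^^ n \<Longrightarrow> pmf (law (return_pmf s) n) s' > 0"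
proof (induction n arbitrary: s')
  case 0
  then show ?case by simp
next
  case (Suc n)
  then obtain z where z: "(s, z) \<in> arcs ^^ n" "(z, s') \<in> arcs" by auto
  have "z \<in> set_pmf (law (return_pmf s) n)" using Suc.IH[OF z(1)] by (simp add: set_pmf_iff)
  moreover have "s' \<in> set_pmf (Q z)" using z(2) by (simp add: arcs_def)
  ultimately have "s' \<in> set_pmf (law (return_pmf s) (Suc n))" by auto
  then show ?case by (simp add: pmf_positive)
qed

lemma arcs_rtrancl_in_S: "(s, s') \<in> arcs\<^sup>* \<Longrightarrow> s \<in> S \<Longrightarrow> s' \<in> S"
  by (induction rule: rtrancl_induct) (use closed in \<open>auto simp: arcs_def\<close>)

text \<open>
  From a transient state one can move to a state that reaches strictly fewer states; in a finite
  chain this descent ends in \<open>C\<close>.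
\<close>

lemma reaches_class:
  assumes trans: "\<And>s. s \<in> S - C \<Longrightarrow> transient_state arcs s" and "s \<in> S"
  shows "\<exists>c\<in>C. (s, c) \<in> arcs\<^sup>*"
  using \<open>s \<in> S\<close>
proof (induction "card (arcs\<^sup>* `` {s})" arbitrary: s rule: less_induct)
  case less
  show ?case
  proof (cases "s \<in> C")
    case False
    then obtain s' where s': "(s, s') \<in> arcs\<^sup>*" "(s', s) \<notin> arcs\<^sup>*"
      using trans less.prems by (auto simp: transient_state_def)
    have "arcs\<^sup>* `` {s'} \<subset> arcs\<^sup>* `` {s}" using s' by auto
    moreover have "finite (arcs\<^sup>* `` {s})"
      using arcs_rtrancl_in_S less.prems by (intro finite_subset[OF _ fin]) auto
    ultimately have "card (arcs\<^sup>* `` {s'}) < card (arcs\<^sup>* `` {s})"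
      by (rule psubset_card_mono[rotated])
    then obtain c where "c \<in> C" "(s', c) \<in> arcs\<^sup>*"
      using less.hyps arcs_rtrancl_in_S s'(1) less.prems by blast
    then show ?thesis using s'(1) by (meson rtrancl_trans)
  qed auto
qed

text \<open>
  The number of steps must be the same for all starting states. Aperiodicity allows this: after
  reaching \<open>z\<close>, the remaining time can be filled with a return to \<open>z\<close>, once it is long enough.
\<close>

lemma common_target:
  assumes C: "ergodic_class arcs C" and trans: "\<And>s. s \<in> S - C \<Longrightarrow> transient_state arcs s"
  shows "\<exists>z m. z \<in> C \<and> (\<forall>s\<in>S. (s, z) \<in> arcs ^^ m)"
proof -
  obtain z where z: "z \<in> C" using C by (auto simp: ergodic_class_def)
  have "\<exists>N. \<forall>n\<ge>N. n \<in> {n. (z, z) \<in> arcs ^^ n}"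
  proof (rule additive_Gcd_1_cofinite)
    show "m + n \<in> {n. (z, z) \<in> arcs ^^ n}"
      if "m \<in> {n. (z, z) \<in> arcs ^^ n}" "n \<in> {n. (z, z) \<in> arcs ^^ n}" for m n
      using that by (auto simp: relpow_add)
    have "{n. (z, z) \<in> arcs ^^ n} - {0} = {m. 0 < m \<and> (z, z) \<in> arcs ^^ m}" by auto
    then show "Gcd ({n. (z, z) \<in> arcs ^^ n} - {0}) = 1"
      using C z by (simp add: ergodic_class_def)
  qed simp
  then obtain N where N: "\<And>n. n \<ge> N \<Longrightarrow> (z, z) \<in> arcs ^^ n" by auto
  have "\<exists>n. (s, z) \<in> arcs ^^ n" if s: "s \<in> S" for s
  proof -
    obtain c where "c \<in> C" "(s, c) \<in> arcs\<^sup>*" using reaches_class[OF trans s] by auto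
    moreover have "(c, z) \<in> arcs\<^sup>*" using C z \<open>c \<in> C\<close> by (auto simp: ergodic_class_def)
    ultimately show ?thesis by (meson rtrancl_trans rtrancl_imp_relpow)
  qed
  then obtain n where n: "\<And>s. s \<in> S \<Longrightarrow> (s, z) \<in> arcs ^^ n s" by metis
  define m where "m = (\<Sum>s\<in>S. n s) + N"
  have "(s, z) \<in> arcs ^^ m" if s: "s \<in> S" for s
  proof -
    have "n s \<le> (\<Sum>s\<in>S. n s)" using fin s by (intro member_le_sum) auto
    then have split: "n s + (m - n s) = m" and "m - n s \<ge> N" by (auto simp: m_def)
    have "(s, z) \<in> arcs ^^ n s O arcs ^^ (m - n s)"
      using n[OF s] N[OF \<open>m - n s \<ge> N\<close>] by (rule relcompI)
    then have "(s, z) \<in> arcs ^^ (n s + (m - n s))" by (simp only: relpow_add)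
    then show ?thesis by (simp only: split)
  qed
  then show ?thesis using z by blast
qed

text \<open>
  After the common number \<open>m\<close> of steps, every row of the transition matrix has positive weight at
  the same state, so a block of \<open>m\<close> steps contracts. Vectors of total zero keep total zero, and the
  blocks can be iterated.
\<close>

lemma geometric_contraction:
  assumes C: "C \<subseteq> S" "ergodic_class arcs C" and trans: "\<And>s. s \<in> S - C \<Longrightarrow> transient_state arcs s"
  shows "\<exists>m r. 0 \<le> r \<and> r < 1 \<and>
    (\<forall>h n. (\<Sum>s\<in>S. h s) = 0 \<longrightarrow> mass ((push ^^ (m * n)) h) \<le> r ^ n * mass h)"
proof -
  obtain z m where zC: "z \<in> C" and reach: "\<And>s. s \<in> S \<Longrightarrow> (s, z) \<in> arcs ^^ m"
    using common_target[OF C(2) trans] by blast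
  have z: "z \<in> S" using zC C(1) by auto
  define e where "e = Min ((\<lambda>s. pmf (law (return_pmf s) m) z) ` S)"
  have e_le: "e \<le> pmf (law (return_pmf s) m) z" if "s \<in> S" for s
    using that fin by (simp add: e_def)
  have e_pos: "e > 0"
    unfolding e_def using fin z law_pos_of_relpow[OF reach] by (subst Min_gr_iff) auto
  have e1: "e \<le> 1" using e_le[OF z] pmf_le_1[of "law (return_pmf z) m" z] by linarith
  have one: "mass ((push ^^ m) h) \<le> (1 - e) * mass h" if "(\<Sum>s\<in>S. h s) = 0" for h
  proof -
    have "mass ((push ^^ m) h) = mass (\<lambda>s'. \<Sum>s\<in>S. h s * pmf (law (return_pmf s) m) s')"
      unfolding mass_def by (intro sum.cong) (auto simp: push_iterate)
    also have "\<dots> \<le> (1 - e) * mass h"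
      using set_law e_le z that by (intro kernel_contracts) auto
    finally show ?thesis .
  qed
  have "mass ((push ^^ (m * n)) h) \<le> (1 - e) ^ n * mass h" if h: "(\<Sum>s\<in>S. h s) = 0" for h n
  proof (induction n)
    case (Suc n)
    have "(push ^^ (m * Suc n)) h = (push ^^ m) ((push ^^ (m * n)) h)"
      by (simp add: funpow_add)
    then have "mass ((push ^^ (m * Suc n)) h) \<le> (1 - e) * mass ((push ^^ (m * n)) h)"
      using one sum_push_iterate h by simp
    also have "\<dots> \<le> (1 - e) * ((1 - e) ^ n * mass h)"
      using Suc e1 by (intro mult_left_mono) auto
    finally show ?case by simp
  qed simp
  then show ?thesis using e_pos e1 by (intro exI[of _ m] exI[of _ "1 - e"]) auto
qed

lemma mass_diff_le:
  assumes "set_pmf \<mu> \<subseteq> S" "set_pmf \<nu> \<subseteq> S"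
  shows "mass (\<lambda>s. pmf \<mu> s - pmf \<nu> s) \<le> 2"
proof -
  have "mass (\<lambda>s. pmf \<mu> s - pmf \<nu> s) \<le> (\<Sum>s\<in>S. pmf \<mu> s + pmf \<nu> s)"
    unfolding mass_def by (intro sum_mono) (auto simp: abs_le_iff)
  also have "\<dots> = 2" using assms fin by (simp add: sum.distrib sum_pmf_eq_1)
  finally show ?thesis .
qed

text \<open>
  For \<open>t \<ge> m * n\<close>, the laws at times \<open>t\<close> and \<open>m * n\<close> arise from the laws at times \<open>t - m * n\<close> and
  \<open>0\<close> by the same \<open>m * n\<close> steps, so they differ by at most \<open>2 * r ^ n\<close>. This gives the Cauchy
  property without an invariant distribution at hand; its existence is then a consequence.
\<close>

theorem converges:
  assumes C: "C \<subseteq> S" "ergodic_class arcs C" and trans: "\<And>s. s \<in> S - C \<Longrightarrow> transient_state arcs s"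
    and \<mu>: "set_pmf \<mu> \<subseteq> S" and s: "s \<in> S"
  shows "convergent (\<lambda>t. pmf (law \<mu> t) s)"
proof -
  have ne: "S \<noteq> {}" using s by auto
  obtain m r where r: "0 \<le> r" "r < 1" and
    contr: "\<And>h n. (\<Sum>s\<in>S. h s) = 0 \<Longrightarrow> mass ((push ^^ (m * n)) h) \<le> r ^ n * mass h"
    using geometric_contraction[OF C trans] by blast
  have close: "\<bar>pmf (law \<mu> t) s - pmf (law \<mu> (m * n)) s\<bar> \<le> r ^ n * 2" if t: "t \<ge> m * n" for t n
  proof -
    define h where "h s = pmf (law \<mu> (t - m * n)) s - pmf \<mu> s" for s
    have h0: "(\<Sum>s\<in>S. h s) = 0"
      unfolding h_def using set_law[OF \<mu>] \<mu> fin by (simp add: sum_subtractf sum_pmf_eq_1)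
    have "(push ^^ (m * n)) h s = pmf (law \<mu> t) s - pmf (law \<mu> (m * n)) s"
      unfolding h_def[abs_def] push_iterate_diff[OF s]
      using push_law[OF \<mu>, of "m * n" "t - m * n"] push_law[OF \<mu>, of "m * n" 0] t by simp
    then have "\<bar>pmf (law \<mu> t) s - pmf (law \<mu> (m * n)) s\<bar> \<le> mass ((push ^^ (m * n)) h)"
      using abs_le_mass[OF s] by metis
    also have "\<dots> \<le> r ^ n * mass h" by (rule contr[OF h0])
    also have "\<dots> \<le> r ^ n * 2"
      unfolding h_def using mass_diff_le[OF set_law[OF \<mu>] \<mu>] r by (intro mult_left_mono) auto
    finally show ?thesis .
  qed
  have "Cauchy (\<lambda>t. pmf (law \<mu> t) s)"
  proof (rule metric_CauchyI)
    fix e :: real assume e: "e > 0"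
    have "(\<lambda>n. r ^ n * 4) \<longlonglongrightarrow> 0"
      using r by (intro tendsto_mult_left_zero LIMSEQ_power_zero) auto
    then have "eventually (\<lambda>n. r ^ n * 4 < e) sequentially"
      using e by (rule order_tendstoD(2))
    then obtain n where n: "r ^ n * 4 < e" by (auto simp: eventually_sequentially)
    have "dist (pmf (law \<mu> a) s) (pmf (law \<mu> b) s) < e" if "a \<ge> m * n" "b \<ge> m * n" for a b
      using close[OF that(1)] close[OF that(2)] n unfolding dist_real_def by linarith
    then show "\<exists>M. \<forall>a\<ge>M. \<forall>b\<ge>M. dist (pmf (law \<mu> a) s) (pmf (law \<mu> b) s) < e" by blast
  qed
  then show ?thesis by (rule Cauchy_convergent)
qed

lemma law_tendsto_invariant:
  assumes lim: "\<And>s. s \<in> S \<Longrightarrow> (\<lambda>t. pmf (law \<mu> t) s) \<longlonglongrightarrow> p s" and \<mu>: "set_pmf \<mu> \<subseteq> S"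
    and s: "s \<in> S"
  shows "p s = push p s"
proof (rule LIMSEQ_unique)
  show "(\<lambda>t. pmf (law \<mu> (Suc t)) s) \<longlonglongrightarrow> p s" using lim[OF s] by (rule LIMSEQ_Suc)
  show "(\<lambda>t. pmf (law \<mu> (Suc t)) s) \<longlonglongrightarrow> push p s"
    unfolding pmf_law_Suc[OF \<mu>] push_def using lim by (intro tendsto_intros)
qed

theorem invariant_unique:
  assumes C: "C \<subseteq> S" "ergodic_class arcs C" and trans: "\<And>s. s \<in> S - C \<Longrightarrow> transient_state arcs s"
    and p: "\<And>s. s \<in> S \<Longrightarrow> p s = push p s" and q: "\<And>s. s \<in> S \<Longrightarrow> q s = push q s"
    and same: "(\<Sum>s\<in>S. p s) = (\<Sum>s\<in>S. q s)" and s: "s \<in> S"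
  shows "p s = q s"
proof -
  obtain m r where r: "0 \<le> r" "r < 1" and
    contr: "\<And>h n. (\<Sum>s\<in>S. h s) = 0 \<Longrightarrow> mass ((push ^^ (m * n)) h) \<le> r ^ n * mass h"
    using geometric_contraction[OF C trans] by blast
  define h where "h s = p s - q s" for s
  have h0: "(\<Sum>s\<in>S. h s) = 0" using same by (simp add: h_def sum_subtractf)
  have inv: "(push ^^ n) h s = h s" if "s \<in> S" for n s
    using that
  proof (induction n arbitrary: s)
    case (Suc n)
    have "(push ^^ Suc n) h s = push h s" using push_cong[OF Suc.IH] by simp
    also have "\<dots> = push p s - push q s"
      by (simp add: push_def h_def left_diff_distrib sum_subtractf)
    also have "\<dots> = h s" using p[OF Suc.prems] q[OF Suc.prems] by (simp add: h_def)
    finally show ?case .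
  qed simp
  have "mass h = mass ((push ^^ (m * 1)) h)" using inv by (simp add: mass_def)
  then have "mass h \<le> r * mass h" using contr[OF h0, of 1] by simp
  then have "(1 - r) * mass h \<le> 0" by (simp add: algebra_simps)
  then have "mass h \<le> 0" using r by (simp add: mult_le_0_iff)
  then have "\<bar>h s\<bar> \<le> 0" using abs_le_mass[OF s, of h] by linarith
  then show ?thesis by (simp add: h_def)
qed

end


section \<open>Independence of the players' chains\<close>

definition own_step :: "('i, 's, 'a) csgame \<Rightarrow> 'i \<Rightarrow> ('s \<Rightarrow> 'a pmf) \<Rightarrow> 's \<Rightarrow> 's pmf" where
  "own_step G i g s = bind_pmf (g s) (kernel G i s)"

definition state_law :: "('i, 's, 'a) csgame \<Rightarrow> 'i \<Rightarrow> ('s \<Rightarrow> 'a pmf) \<Rightarrow> nat \<Rightarrow> 's pmf" where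
  "state_law G i g = finite_chain.law (own_step G i g) (init G i)"

definition pair_law :: "('i, 's, 'a) csgame \<Rightarrow> 'i \<Rightarrow> ('s \<Rightarrow> 'a pmf) \<Rightarrow> nat \<Rightarrow> ('s \<times> 'a) pmf" where
  "pair_law G i g t = bind_pmf (state_law G i g t) (\<lambda>s. map_pmf (Pair s) (g s))"

lemma game_dataD:
  assumes "game_data G"
  shows "finite (states G i)" "set_pmf (init G i) \<subseteq> states G i"
    "s \<in> states G i \<Longrightarrow> finite (acts G i s)" "s \<in> states G i \<Longrightarrow> acts G i s \<noteq> {}"
    "s \<in> states G i \<Longrightarrow> a \<in> acts G i s \<Longrightarrow> set_pmf (kernel G i s a) \<subseteq> states G i"
  using assms unfolding game_data_def by blast+

lemma finite_pairs: "game_data G \<Longrightarrow> finite (pairs G i)"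
  unfolding pairs_def by (intro finite_SigmaI) (auto dest: game_dataD)

lemma sum_pairs:
  "game_data G \<Longrightarrow> (\<Sum>w\<in>pairs G i. F w) = (\<Sum>s\<in>states G i. \<Sum>a\<in>acts G i s. F (s, a))"
  unfolding pairs_def by (subst sum.Sigma) (auto dest: game_dataD)

lemma finite_chain_own_step:
  assumes "game_data G" and "is_stationary G i g"
  shows "finite_chain (states G i) (own_step G i g)"
proof
  show "finite (states G i)" using game_dataD[OF assms(1)] by blast
  show "set_pmf (own_step G i g s) \<subseteq> states G i" if "s \<in> states G i" for s
    using game_dataD(5)[OF assms(1) that] assms(2) that
    by (fastforce simp: own_step_def is_stationary_def)
qed

lemma state_law_Suc:
  assumes "game_data G" and "is_stationary G i g"
  shows "state_law G i g (Suc t) = bind_pmf (state_law G i g t) (own_step G i g)"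
  using finite_chain.law.simps[OF finite_chain_own_step[OF assms]] by (simp add: state_law_def)

lemma state_law_0:
  assumes "game_data G" and "is_stationary G i g"
  shows "state_law G i g 0 = init G i"
  using finite_chain.law.simps[OF finite_chain_own_step[OF assms]] by (simp add: state_law_def)

lemma set_state_law:
  assumes "game_data G" and "is_stationary G i g"
  shows "set_pmf (state_law G i g t) \<subseteq> states G i"
  unfolding state_law_def
  using finite_chain.set_law[OF finite_chain_own_step[OF assms]] game_dataD[OF assms(1)] by blast

text \<open>
  Under stationary strategies neither actions nor transitions look at the history, so the history
  may be forgotten. Each step draws the components independently given the components of the current
  state, which preserves the product form.
\<close>

lemma current_state_law:
  fixes G :: "('i::finite, 's, 'a) csgame"
  assumes "game_data G" and f: "stationary_multi G f"
  shows "map_pmf snd (history_law G (use_always f) t)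
    = Pi_pmf UNIV undefined (\<lambda>i. state_law G i (f i) t)"
proof (induction t)
  case 0
  have "state_law G i (f i) 0 = init G i" for i
    using assms by (simp add: state_law_0 stationary_multi_def)
  then show ?case by (simp add: pmf.map_comp o_def)
next
  case (Suc t)
  have "map_pmf snd (history_law G (use_always f) (Suc t)) =
    bind_pmf (history_law G (use_always f) t) (\<lambda>hx.
      bind_pmf (Pi_pmf UNIV undefined (\<lambda>i. f i (snd hx i))) (\<lambda>a.
      Pi_pmf UNIV undefined (\<lambda>i. kernel G i (snd hx i) (a i))))"
    by (simp add: map_bind_pmf pmf.map_comp o_def case_prod_unfold act_law_def use_always_def)
  also have "\<dots> = bind_pmf (history_law G (use_always f) t) (\<lambda>hx.
      Pi_pmf UNIV undefined (\<lambda>i. own_step G i (f i) (snd hx i)))"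
    unfolding own_step_def by (subst Pi_pmf_bind[where d' = undefined]) simp_all
  also have "\<dots> = bind_pmf (map_pmf snd (history_law G (use_always f) t)) (\<lambda>x.
      Pi_pmf UNIV undefined (\<lambda>i. own_step G i (f i) (x i)))"
    by (simp add: bind_map_pmf)
  also have "\<dots> = Pi_pmf UNIV undefined (\<lambda>i. bind_pmf (state_law G i (f i) t) (own_step G i (f i)))"
    unfolding Suc by (subst Pi_pmf_bind[where d' = undefined]) simp_all
  also have "\<dots> = Pi_pmf UNIV undefined (\<lambda>i. state_law G i (f i) (Suc t))"
    using assms by (simp add: state_law_Suc stationary_multi_def)
  finally show ?case .
qed

lemma state_action_law_product:
  fixes G :: "('i::finite, 's, 'a) csgame"
  assumes "game_data G" and f: "stationary_multi G f"
  shows "state_action_law G (use_always f) t = Pi_pmf UNIV undefined (\<lambda>i. pair_law G i (f i) t)"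
proof -
  have "state_action_law G (use_always f) t =
    bind_pmf (map_pmf snd (history_law G (use_always f) t)) (\<lambda>x.
      map_pmf (\<lambda>a i. (x i, a i)) (Pi_pmf UNIV undefined (\<lambda>i. f i (x i))))"
    by (simp add: state_action_law_def bind_map_pmf case_prod_unfold act_law_def use_always_def)
  also have "\<dots> = bind_pmf (Pi_pmf UNIV undefined (\<lambda>i. state_law G i (f i) t)) (\<lambda>x.
      Pi_pmf UNIV undefined (\<lambda>i. map_pmf (Pair (x i)) (f i (x i))))"
  proof -
    have "map_pmf (\<lambda>a i. (x i, a i)) (Pi_pmf UNIV undefined (\<lambda>i. f i (x i))) =
      Pi_pmf UNIV undefined (\<lambda>i. map_pmf (Pair (x i)) (f i (x i)))" for x
      unfolding map_pmf_def by (subst Pi_pmf_bind[where d' = undefined]) simp_all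
    then show ?thesis by (simp add: current_state_law[OF assms])
  qed
  also have "\<dots> = Pi_pmf UNIV undefined (\<lambda>i. pair_law G i (f i) t)"
    unfolding pair_law_def by (subst Pi_pmf_bind[where d' = undefined]) simp_all
  finally show ?thesis .
qed

lemma pmf_pair_law:
  assumes "game_data G" and "is_stationary G i g" and s: "s \<in> states G i"
  shows "pmf (pair_law G i g t) (s, a) = pmf (state_law G i g t) s * pmf (g s) a"
proof -
  have pair: "pmf (map_pmf (Pair s') (g s')) (s, a) = (if s' = s then pmf (g s) a else 0)" for s'
    by (auto simp: pmf_map_inj' inj_on_def intro!: pmf_map_outside)
  show ?thesis
    unfolding pair_law_def
      finite_chain.pmf_bind_on_S[OF finite_chain_own_step[OF assms(1,2)] set_state_law[OF assms(1,2)]]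
      pair
    using s game_dataD(1)[OF assms(1), of i] by (simp add: if_distrib sum.delta cong: if_cong)
qed

lemma set_pair_law:
  assumes "game_data G" and "is_stationary G i g"
  shows "set_pmf (pair_law G i g t) \<subseteq> pairs G i"
  using set_state_law[OF assms, of t] assms(2)
  by (fastforce simp: pair_law_def pairs_def is_stationary_def)

lemma expectation_product:
  fixes G :: "('i::finite, 's, 'a) csgame"
  assumes "game_data G" and P: "\<And>i. set_pmf (P i) \<subseteq> pairs G i"
  shows "measure_pmf.expectation (Pi_pmf UNIV undefined P) r = joint_sum G (\<lambda>i. pmf (P i)) r"
proof -
  have fin: "finite (joint_pairs G)"
    unfolding joint_pairs_def using finite_pairs[OF assms(1)] by (intro finite_PiE) auto
  have "measure_pmf.expectation (Pi_pmf UNIV undefined P) r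
    = (\<Sum>w\<in>joint_pairs G. r w * pmf (Pi_pmf UNIV undefined P) w)"
  proof (rule integral_measure_pmf_real[OF fin])
    fix w
    assume "w \<in> set_pmf (Pi_pmf UNIV undefined P)"
    then have "\<forall>i. w i \<in> set_pmf (P i)" by (auto simp: set_Pi_pmf PiE_dflt_def)
    then show "w \<in> joint_pairs G" using P by (auto simp: joint_pairs_def)
  qed
  also have "\<dots> = joint_sum G (\<lambda>i. pmf (P i)) r"
    unfolding joint_sum_def by (intro sum.cong) (auto simp: pmf_Pi)
  finally show ?thesis .
qed


section \<open>Occupation measures\<close>

text \<open>
  \<open>freq G i g\<close> is the vector of long-run state-action frequencies of the strategy \<open>g\<close>, and
  \<open>occupation\<close> describes, without reference to strategies, which vectors arise as frequencies: the
  probability vectors for which every state is entered as often as it is left.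
\<close>

definition long_run :: "('i, 's, 'a) csgame \<Rightarrow> 'i \<Rightarrow> ('s \<Rightarrow> 'a pmf) \<Rightarrow> 's \<Rightarrow> real" where
  "long_run G i g s = lim (\<lambda>t. pmf (state_law G i g t) s)"

definition freq :: "('i, 's, 'a) csgame \<Rightarrow> 'i \<Rightarrow> ('s \<Rightarrow> 'a pmf) \<Rightarrow> 's \<times> 'a \<Rightarrow> real" where
  "freq G i g = (\<lambda>(s, a). long_run G i g s * pmf (g s) a)"

definition net_outflow :: "('i, 's, 'a) csgame \<Rightarrow> 'i \<Rightarrow> 's \<Rightarrow> ('s \<times> 'a \<Rightarrow> real) \<Rightarrow> real" where
  "net_outflow G i s' y =
     (\<Sum>(s, a)\<in>pairs G i. (of_bool (s = s') - pmf (kernel G i s a) s') * y (s, a))"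

definition occupation :: "('i, 's, 'a) csgame \<Rightarrow> 'i \<Rightarrow> ('s \<times> 'a \<Rightarrow> real) \<Rightarrow> bool" where
  "occupation G i y \<longleftrightarrow> (\<forall>s\<in>states G i. net_outflow G i s y = 0) \<and>
     (\<Sum>w\<in>pairs G i. y w) = 1 \<and> (\<forall>w\<in>pairs G i. 0 \<le> y w)"

lemma pmf_of_weights:
  fixes m :: "'b \<Rightarrow> real"
  assumes "finite A" "\<And>a. a \<in> A \<Longrightarrow> 0 \<le> m a" "(\<Sum>a\<in>A. m a) = 1"
  shows "\<exists>p. set_pmf p \<subseteq> A \<and> (\<forall>a\<in>A. pmf p a = m a)"
proof -
  define m' where "m' a = (if a \<in> A then m a else 0)" for a
  have nonneg: "0 \<le> m' a" for a using assms(2) by (simp add: m'_def)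
  have "(\<integral>\<^sup>+ a. ennreal (m' a) \<partial>count_space UNIV) = (\<Sum>a\<in>A. ennreal (m' a))"
    using assms(1) by (intro nn_integral_count_space') (auto simp: m'_def)
  also have "\<dots> = ennreal (\<Sum>a\<in>A. m' a)" using nonneg by (intro sum_ennreal) auto
  also have "(\<Sum>a\<in>A. m' a) = 1" using assms(3) by (simp add: m'_def)
  finally have "pmf (embed_pmf m') a = m' a" for a
    using nonneg by (intro pmf_embed_pmf) auto
  then show ?thesis by (intro exI[of _ "embed_pmf m'"]) (auto simp: set_pmf_eq m'_def)
qed

locale ergodic_game =
  fixes G :: "('i::finite, 's, 'a) csgame"
  assumes data: "game_data G" and ergodic: "ergodicity G"
begin

lemma ergodic_arcs:
  assumes "is_stationary G i g"
  obtains C where "C \<subseteq> states G i" "ergodic_class (finite_chain.arcs (states G i) (own_step G i g)) C"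
    "\<And>s. s \<in> states G i - C \<Longrightarrow> transient_state (finite_chain.arcs (states G i) (own_step G i g)) s"
proof -
  have "finite_chain.arcs (states G i) (own_step G i g) = chain_step G i g"
    unfolding finite_chain.arcs_def[OF finite_chain_own_step[OF data assms]]
    by (simp add: chain_step_def own_step_def[abs_def])
  then show ?thesis using ergodic assms that unfolding ergodicity_def by metis
qed

lemma state_law_tendsto:
  assumes g: "is_stationary G i g" and s: "s \<in> states G i"
  shows "(\<lambda>t. pmf (state_law G i g t) s) \<longlonglongrightarrow> long_run G i g s"
proof -
  obtain C where "C \<subseteq> states G i" "ergodic_class (finite_chain.arcs (states G i) (own_step G i g)) C"
    "\<And>s. s \<in> states G i - C \<Longrightarrow> transient_state (finite_chain.arcs (states G i) (own_step G i g)) s"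
    using ergodic_arcs[OF g] by blast
  then have "convergent (\<lambda>t. pmf (state_law G i g t) s)"
    unfolding state_law_def
    using finite_chain.converges[OF finite_chain_own_step[OF data g]] game_dataD(2)[OF data] s
    by blast
  then show ?thesis unfolding long_run_def by (rule convergent_LIMSEQ_iff[THEN iffD1])
qed

lemma sum_long_run:
  assumes g: "is_stationary G i g"
  shows "(\<Sum>s\<in>states G i. long_run G i g s) = 1"
proof (rule LIMSEQ_unique)
  show "(\<lambda>t. \<Sum>s\<in>states G i. pmf (state_law G i g t) s) \<longlonglongrightarrow> (\<Sum>s\<in>states G i. long_run G i g s)"
    using state_law_tendsto[OF g] by (intro tendsto_sum)
  show "(\<lambda>t. \<Sum>s\<in>states G i. pmf (state_law G i g t) s) \<longlonglongrightarrow> 1"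
    using sum_pmf_eq_1[OF game_dataD(1)[OF data] set_state_law[OF data g]] by simp
qed

lemma long_run_nonneg:
  assumes g: "is_stationary G i g" and s: "s \<in> states G i"
  shows "0 \<le> long_run G i g s"
  using state_law_tendsto[OF assms] by (rule LIMSEQ_le_const) simp

lemma long_run_invariant:
  assumes g: "is_stationary G i g" and s: "s \<in> states G i"
  shows "long_run G i g s = finite_chain.push (states G i) (own_step G i g) (long_run G i g) s"
  using finite_chain.law_tendsto_invariant[OF finite_chain_own_step[OF data g], of "init G i"]
    state_law_tendsto[OF g] game_dataD(2)[OF data] s unfolding state_law_def by blast

lemma sum_action_pmf:
  assumes "is_stationary G i g" and "s \<in> states G i"
  shows "(\<Sum>a\<in>acts G i s. pmf (g s) a) = 1"
  using game_dataD(3)[OF data] assms by (simp add: sum_pmf_eq_1 is_stationary_def)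

text \<open>
  Once \<open>y\<close> is split into a state marginal \<open>p\<close> and the strategy \<open>g\<close>, flow balance says that \<open>p\<close> is
  invariant under the chain that \<open>g\<close> induces.
\<close>

lemma net_outflow_factored:
  assumes g: "is_stationary G i g" and s': "s' \<in> states G i"
    and y: "\<And>s a. s \<in> states G i \<Longrightarrow> a \<in> acts G i s \<Longrightarrow> y (s, a) = p s * pmf (g s) a"
  shows "net_outflow G i s' y = p s' - finite_chain.push (states G i) (own_step G i g) p s'"
proof -
  have step: "pmf (own_step G i g s) s' = (\<Sum>a\<in>acts G i s. pmf (g s) a * pmf (kernel G i s a) s')"
    if "s \<in> states G i" for s
    unfolding own_step_def pmf_bind using that g game_dataD(3)[OF data that]
    by (subst integral_measure_pmf_real[of "acts G i s"]) (auto simp: is_stationary_def mult.commute)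
  have "net_outflow G i s' y = (\<Sum>s\<in>states G i. p s * (\<Sum>a\<in>acts G i s.
      of_bool (s = s') * pmf (g s) a - pmf (g s) a * pmf (kernel G i s a) s'))"
    unfolding net_outflow_def sum_pairs[OF data] sum_distrib_left
    by (intro sum.cong) (auto simp: y algebra_simps)
  also have "\<dots> = (\<Sum>s\<in>states G i. of_bool (s = s') * p s - p s * pmf (own_step G i g s) s')"
    by (intro sum.cong refl)
      (auto simp: step sum_action_pmf[OF g] sum_subtractf algebra_simps simp flip: sum_distrib_left)
  also have "\<dots> = p s' - finite_chain.push (states G i) (own_step G i g) p s'"
    unfolding finite_chain.push_def[OF finite_chain_own_step[OF data g]] sum_subtractf
    using s' game_dataD(1)[OF data, of i] by (simp add: of_bool_def if_distrib[of "\<lambda>b. b * _"]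
        cong: if_cong)
  finally show ?thesis .
qed

lemma occupation_freq:
  assumes g: "is_stationary G i g"
  shows "occupation G i (freq G i g)"
  unfolding occupation_def
proof (intro conjI ballI)
  show "net_outflow G i s (freq G i g) = 0" if "s \<in> states G i" for s
    using net_outflow_factored[OF g that, of "freq G i g" "long_run G i g"]
      long_run_invariant[OF g that] by (simp add: freq_def)
  have "(\<Sum>w\<in>pairs G i. freq G i g w)
      = (\<Sum>s\<in>states G i. long_run G i g s * (\<Sum>a\<in>acts G i s. pmf (g s) a))"
    by (simp add: sum_pairs[OF data] freq_def sum_distrib_left)
  then show "(\<Sum>w\<in>pairs G i. freq G i g w) = 1"
    using sum_action_pmf[OF g] sum_long_run[OF g] by simp
  show "0 \<le> freq G i g w" if "w \<in> pairs G i" for w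
    using that long_run_nonneg[OF g] by (auto simp: freq_def pairs_def)
qed

definition reads_off :: "'i \<Rightarrow> ('s \<times> 'a \<Rightarrow> real) \<Rightarrow> ('s \<Rightarrow> 'a pmf) \<Rightarrow> bool" where
  "reads_off i y g \<longleftrightarrow> (\<forall>s\<in>states G i. \<forall>a\<in>acts G i s. (\<Sum>b\<in>acts G i s. y (s, b)) \<noteq> 0 \<longrightarrow>
     pmf (g s) a = y (s, a) / (\<Sum>b\<in>acts G i s. y (s, b)))"

text \<open>
  The arbitrary choice of \<open>g\<close> where the marginal of \<open>y\<close> vanishes is harmless: there \<open>y\<close> itself
  vanishes, so \<open>y\<close> is the product of its marginal and \<open>g\<close> at every state. The marginal is invariant and
  thus equal to the long-run distribution of \<open>g\<close>.
\<close>

lemma freq_of_reads_off: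
  assumes g: "is_stationary G i g" and y: "occupation G i y" and read: "reads_off i y g"
    and w: "w \<in> pairs G i"
  shows "freq G i g w = y w"
proof -
  define p where "p s = (\<Sum>b\<in>acts G i s. y (s, b))" for s
  have y_eq: "y (s, a) = p s * pmf (g s) a" if sa: "s \<in> states G i" "a \<in> acts G i s" for s a
  proof (cases "p s = 0")
    case True
    have "0 \<le> y (s, b)" if "b \<in> acts G i s" for b
      using y sa that by (auto simp: occupation_def pairs_def)
    then have "\<forall>b\<in>acts G i s. y (s, b) = 0"
      using True game_dataD(3)[OF data sa(1)] by (simp add: p_def sum_nonneg_eq_0_iff)
    then have "y (s, a) = 0" using sa(2) by blast
    then show ?thesis using True by simp
  next
    case False
    then show ?thesis using read sa by (simp add: reads_off_def p_def)
  qed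
  have inv: "p s = finite_chain.push (states G i) (own_step G i g) p s" if "s \<in> states G i" for s
    using net_outflow_factored[OF g that, of y p] y_eq y that by (simp add: occupation_def)
  have total: "(\<Sum>s\<in>states G i. p s) = 1"
    using y by (simp add: occupation_def p_def sum_pairs[OF data])
  obtain C where C: "C \<subseteq> states G i" "ergodic_class (finite_chain.arcs (states G i) (own_step G i g)) C"
    "\<And>s. s \<in> states G i - C \<Longrightarrow> transient_state (finite_chain.arcs (states G i) (own_step G i g)) s"
    using ergodic_arcs[OF g] by blast
  have "long_run G i g s = p s" if "s \<in> states G i" for s
    by (rule finite_chain.invariant_unique[OF finite_chain_own_step[OF data g] C
          long_run_invariant[OF g] inv _ that])
      (simp_all add: sum_long_run[OF g] total)
  then show ?thesis using w y_eq by (auto simp: freq_def pairs_def)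
qed

lemma reads_off_exists:
  assumes y: "occupation G i y"
  shows "\<exists>g. is_stationary G i g \<and> reads_off i y g"
proof -
  have "\<exists>q. s \<in> states G i \<longrightarrow> set_pmf q \<subseteq> acts G i s \<and>
    (\<forall>a\<in>acts G i s. (\<Sum>b\<in>acts G i s. y (s, b)) \<noteq> 0 \<longrightarrow>
     pmf q a = y (s, a) / (\<Sum>b\<in>acts G i s. y (s, b)))" for s
  proof (cases "s \<in> states G i \<and> (\<Sum>b\<in>acts G i s. y (s, b)) \<noteq> 0")
    case True
    then have nonneg: "0 \<le> y (s, a)" if "a \<in> acts G i s" for a
      using y that by (auto simp: occupation_def pairs_def)
    have "(\<Sum>a\<in>acts G i s. y (s, a) / (\<Sum>b\<in>acts G i s. y (s, b))) = 1"
      using True by (simp flip: sum_divide_distrib)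
    then show ?thesis
      using pmf_of_weights[of "acts G i s" "\<lambda>a. y (s, a) / (\<Sum>b\<in>acts G i s. y (s, b))"]
        nonneg game_dataD(3)[OF data] True by (simp add: sum_nonneg)
  next
    case False
    show ?thesis
    proof (cases "s \<in> states G i")
      case True
      then obtain a where "a \<in> acts G i s" using game_dataD(4)[OF data] by blast
      then show ?thesis using False by (intro exI[of _ "return_pmf a"]) auto
    qed simp
  qed
  then obtain g where "\<And>s. s \<in> states G i \<longrightarrow> set_pmf (g s) \<subseteq> acts G i s \<and>
    (\<forall>a\<in>acts G i s. (\<Sum>b\<in>acts G i s. y (s, b)) \<noteq> 0 \<longrightarrow>
     pmf (g s) a = y (s, a) / (\<Sum>b\<in>acts G i s. y (s, b)))" by metis
  then show ?thesis unfolding is_stationary_def reads_off_def by blast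
qed

text \<open>
  Convergence of the individual laws gives convergence of the product laws, hence of the expected
  costs at time \<open>t\<close>, before any averaging. The upper limit of the averages is therefore a limit.
\<close>

lemma avg_cost_stationary:
  assumes f: "stationary_multi G f"
  shows "avg_cost G r (use_always f) = ereal (joint_sum G (\<lambda>i. freq G i (f i)) r)"
proof -
  have fi: "is_stationary G i (f i)" for i using f by (simp add: stationary_multi_def)
  have "measure_pmf.expectation (state_action_law G (use_always f) t) r
    = joint_sum G (\<lambda>i. pmf (pair_law G i (f i) t)) r" for t
    unfolding state_action_law_product[OF data f]
    using expectation_product[OF data set_pair_law[OF data fi]] .
  moreover have "(\<lambda>t. joint_sum G (\<lambda>i. pmf (pair_law G i (f i) t)) r)
    \<longlonglongrightarrow> joint_sum G (\<lambda>i. freq G i (f i)) r"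
    unfolding joint_sum_def
  proof (intro tendsto_sum tendsto_mult tendsto_prod tendsto_const)
    fix w i
    assume "w \<in> joint_pairs G"
    then obtain s a where sa: "w i = (s, a)" "s \<in> states G i"
      by (force simp: joint_pairs_def pairs_def PiE_def Pi_def)
    show "(\<lambda>t. pmf (pair_law G i (f i) t) (w i)) \<longlonglongrightarrow> freq G i (f i) (w i)"
      using state_law_tendsto[OF fi sa(2)]
      by (simp add: sa pmf_pair_law[OF data fi] freq_def tendsto_mult)
  qed
  ultimately have "(\<lambda>t. measure_pmf.expectation (state_action_law G (use_always f) t) r)
    \<longlonglongrightarrow> joint_sum G (\<lambda>i. freq G i (f i)) r" by simp
  from cesaro_limit[OF this] show ?thesis
    unfolding avg_cost_def by (intro lim_imp_Limsup) auto
qed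

end


section \<open>The best-response linear program\<close>

text \<open>
  \<open>response_value G x i r y\<close> is the average of \<open>r\<close> when player \<open>i\<close> has frequencies \<open>y\<close> and the others
  those in \<open>x\<close>. With \<open>x\<close> fixed it is linear in \<open>y\<close>, so minimizing the cost over \<open>primal_feasible\<close>
  points is a linear program; \<open>dual_feasible\<close> and \<open>dual_value\<close> describe its dual.
\<close>

definition response_value ::
  "('i::finite, 's, 'a) csgame \<Rightarrow> ('i \<Rightarrow> 's \<times> 'a \<Rightarrow> real) \<Rightarrow> 'i \<Rightarrow> (('i \<Rightarrow> 's \<times> 'a) \<Rightarrow> real)
     \<Rightarrow> ('s \<times> 'a \<Rightarrow> real) \<Rightarrow> real" where
  "response_value G x i r y = (\<Sum>w\<in>pairs G i. y w * other_sum G x i r w)"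

definition primal_feasible ::
  "('i::finite, 's, 'a) csgame \<Rightarrow> ('i \<Rightarrow> 's \<times> 'a \<Rightarrow> real) \<Rightarrow> 'i \<Rightarrow> ('s \<times> 'a \<Rightarrow> real) \<Rightarrow> bool" where
  "primal_feasible G x i y \<longleftrightarrow> occupation G i y \<and>
     (\<forall>k\<in>{1..num_con G i}. response_value G x i (con_cost G i k) y \<le> con_bound G i k)"

definition dual_feasible ::
  "('i::finite, 's, 'a) csgame \<Rightarrow> ('i \<Rightarrow> 's \<times> 'a \<Rightarrow> real) \<Rightarrow> 'i \<Rightarrow> real \<Rightarrow> ('s \<Rightarrow> real)
     \<Rightarrow> (nat \<Rightarrow> real) \<Rightarrow> bool" where
  "dual_feasible G x i v u d \<longleftrightarrow>
     (\<forall>s\<in>states G i. \<forall>a\<in>acts G i s.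
        v + u s \<le> other_sum G x i (cost G i) (s, a)
          + (\<Sum>k = 1..num_con G i. d k * other_sum G x i (con_cost G i k) (s, a))
          + (\<Sum>s'\<in>states G i. pmf (kernel G i s a) s' * u s')) \<and>
     (\<forall>k\<in>{1..num_con G i}. 0 \<le> d k)"

definition dual_value :: "('i, 's, 'a) csgame \<Rightarrow> 'i \<Rightarrow> real \<Rightarrow> (nat \<Rightarrow> real) \<Rightarrow> real" where
  "dual_value G i v d = v - (\<Sum>k = 1..num_con G i. d k * con_bound G i k)"

lemma other_sum_cong:
  assumes "\<And>j w. j \<noteq> i \<Longrightarrow> w \<in> pairs G j \<Longrightarrow> x j w = x' j w"
  shows "other_sum G x i r sa = other_sum G x' i r sa"
  unfolding other_sum_def
proof (intro sum.cong refl arg_cong2[where f = "(*)"] prod.cong)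
  fix w j
  assume "w \<in> other_pairs G i" "j \<in> UNIV - {i}"
  then show "x j (w j) = x' j (w j)"
    by (intro assms) (auto simp: other_pairs_def PiE_def Pi_def)
qed

lemma joint_sum_split:
  "joint_sum G x r = response_value G x i r (x i)"
proof -
  let ?ins = "\<lambda>(y, g). g(i := y)"
  have split: "joint_pairs G = ?ins ` (pairs G i \<times> other_pairs G i)"
    using PiE_insert_eq[of i "UNIV - {i}" "pairs G"]
    by (simp add: joint_pairs_def other_pairs_def insert_absorb)
  have inj: "inj_on ?ins (pairs G i \<times> other_pairs G i)"
    unfolding other_pairs_def by (rule inj_combinator) simp
  have "joint_sum G x r = (\<Sum>(sa, w)\<in>pairs G i \<times> other_pairs G i.
      (\<Prod>j\<in>UNIV. x j ((w(i := sa)) j)) * r (w(i := sa)))"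
    unfolding joint_sum_def split using inj by (subst sum.reindex) (auto simp: case_prod_unfold)
  also have "\<dots> = (\<Sum>sa\<in>pairs G i. \<Sum>w\<in>other_pairs G i.
      x i sa * ((\<Prod>j\<in>UNIV - {i}. x j (w j)) * r (w(i := sa))))"
    unfolding sum.cartesian_product
  proof (intro sum.cong refl, clarify)
    fix sa w
    have "(\<Prod>j\<in>UNIV. x j ((w(i := sa)) j)) = x i sa * (\<Prod>j\<in>UNIV - {i}. x j ((w(i := sa)) j))"
      by (subst prod.remove[of UNIV i]) auto
    also have "(\<Prod>j\<in>UNIV - {i}. x j ((w(i := sa)) j)) = (\<Prod>j\<in>UNIV - {i}. x j (w j))"
      by (intro prod.cong) auto
    finally show "(\<Prod>j\<in>UNIV. x j ((w(i := sa)) j)) * r (w(i := sa)) =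
      x i sa * ((\<Prod>j\<in>UNIV - {i}. x j (w j)) * r (w(i := sa)))" by simp
  qed
  finally show ?thesis by (simp add: response_value_def other_sum_def sum_distrib_left)
qed

lemma joint_sum_update: "joint_sum G (x(i := y)) r = response_value G x i r y"
  unfolding joint_sum_split[of G "x(i := y)" r i]
  by (simp add: response_value_def cong: other_sum_cong)

lemma response_value_cong:
  assumes "\<And>j w. j \<noteq> i \<Longrightarrow> w \<in> pairs G j \<Longrightarrow> x j w = x' j w" "\<And>w. w \<in> pairs G i \<Longrightarrow> y w = y' w"
  shows "response_value G x i r y = response_value G x' i r y'"
proof -
  have "other_sum G x i r w = other_sum G x' i r w" for w
    using assms(1) by (rule other_sum_cong)
  then show ?thesis unfolding response_value_def using assms(2) by (intro sum.cong) auto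
qed

lemma primal_feasible_cong:
  assumes "\<And>j w. w \<in> pairs G j \<Longrightarrow> x j w = x' j w" "\<And>w. w \<in> pairs G i \<Longrightarrow> y w = y' w"
  shows "primal_feasible G x i y = primal_feasible G x' i y'"
proof -
  have "net_outflow G i s y = net_outflow G i s y'" for s
    unfolding net_outflow_def using assms(2) by (intro sum.cong) auto
  moreover have "(\<Sum>w\<in>pairs G i. y w) = (\<Sum>w\<in>pairs G i. y' w)"
    using assms(2) by (intro sum.cong) auto
  moreover have "response_value G x i r y = response_value G x' i r y'" for r
    using assms by (intro response_value_cong)
  ultimately show ?thesis
    using assms(2) by (simp add: primal_feasible_def occupation_def)
qed

text \<open>
  Average the dual constraints with the weights \<open>y\<close>. The terms with \<open>u\<close> combine to the net outflow
  of \<open>y\<close> and disappear, and the terms with \<open>d\<close> are bounded by the primal constraints.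
\<close>

lemma weak_duality:
  assumes data: "game_data G" and y: "primal_feasible G x i y" and d: "dual_feasible G x i v u d"
  shows "dual_value G i v d \<le> response_value G x i (cost G i) y"
proof -
  let ?c = "other_sum G x i (cost G i)" and ?d = "\<lambda>k. other_sum G x i (con_cost G i k)"
  let ?K = "{1..num_con G i}"
  have occ: "occupation G i y" using y by (simp add: primal_feasible_def)
  let ?drift = "\<lambda>w. \<Sum>s'\<in>states G i. (of_bool (fst w = s') - pmf (kernel G i (fst w) (snd w)) s') * u s'"
  have pointwise: "y w * v \<le> y w * (?c w + (\<Sum>k\<in>?K. d k * ?d k w) - ?drift w)"
    if w: "w \<in> pairs G i" for w
  proof (rule mult_left_mono)
    obtain s a where sa: "w = (s, a)" "s \<in> states G i" "a \<in> acts G i s"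
      using w by (auto simp: pairs_def)
    have "?drift w = u s - (\<Sum>s'\<in>states G i. pmf (kernel G i s a) s' * u s')"
      using sa game_dataD(1)[OF data, of i]
      by (simp add: left_diff_distrib sum_subtractf of_bool_def
          if_distrib[of "\<lambda>b. b * _"] cong: if_cong)
    moreover have "v + u s \<le> ?c w + (\<Sum>k\<in>?K. d k * ?d k w)
        + (\<Sum>s'\<in>states G i. pmf (kernel G i s a) s' * u s')"
      using d sa by (simp add: dual_feasible_def)
    ultimately show "v \<le> ?c w + (\<Sum>k\<in>?K. d k * ?d k w) - ?drift w" by linarith
    show "0 \<le> y w" using occ w by (simp add: occupation_def)
  qed
  have drift: "(\<Sum>w\<in>pairs G i. y w * ?drift w) = 0"
  proof -
    have "(\<Sum>w\<in>pairs G i. y w * ?drift w) = (\<Sum>s'\<in>states G i. net_outflow G i s' y * u s')"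
      unfolding net_outflow_def sum_distrib_left sum_distrib_right case_prod_unfold
      by (subst sum.swap) (simp add: mult_ac)
    also have "\<dots> = 0" using occ by (simp add: occupation_def)
    finally show ?thesis .
  qed
  have "v = (\<Sum>w\<in>pairs G i. y w * v)"
    using occ by (simp add: occupation_def flip: sum_distrib_right)
  also have "\<dots> \<le> (\<Sum>w\<in>pairs G i. y w * (?c w + (\<Sum>k\<in>?K. d k * ?d k w) - ?drift w))"
    using pointwise by (rule sum_mono)
  also have "\<dots> = response_value G x i (cost G i) y + (\<Sum>w\<in>pairs G i. y w * (\<Sum>k\<in>?K. d k * ?d k w))"
    using drift by (simp add: response_value_def algebra_simps sum.distrib sum_subtractf)
  also have "(\<Sum>w\<in>pairs G i. y w * (\<Sum>k\<in>?K. d k * ?d k w)) =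
    (\<Sum>k\<in>?K. d k * response_value G x i (con_cost G i k) y)"
    unfolding response_value_def sum_distrib_left by (subst sum.swap) (simp add: mult_ac)
  also have "\<dots> \<le> (\<Sum>k\<in>?K. d k * con_bound G i k)"
    using y d by (intro sum_mono mult_left_mono) (auto simp: primal_feasible_def dual_feasible_def)
  finally show ?thesis by (simp add: dual_value_def)
qed

lemma response_value_indicator:
  assumes "game_data G" "w \<in> pairs G i"
  shows "response_value G x i r (\<lambda>w'. of_bool (w' = w)) = other_sum G x i r w"
  unfolding response_value_def of_bool_def using finite_pairs[OF assms(1), of i] assms(2)
  by (simp add: if_distrib[of "\<lambda>b. b * _"] cong: if_cong)

text \<open>
  The Farkas lemma speaks of homogeneous constraints, so the normalization of \<open>y\<close> is absorbed: with
  \<open>m\<close> the total weight of \<open>y\<close>, bounds \<open>\<xi>\<close> become \<open>\<xi> * m\<close>, and the lower bound \<open>V\<close> of the program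
  becomes \<open>V * m \<le> cost\<close>. For \<open>m > 0\<close> this follows by rescaling \<open>y\<close> to a feasible point, and for
  \<open>m = 0\<close> nonnegativity makes \<open>y\<close> vanish. The multipliers of flow balance and of the cost
  constraints are \<open>- u\<close> and \<open>d\<close>; those of nonnegativity are the slacks of the dual constraints,
  as evaluation at unit vectors shows.
\<close>

lemma strong_duality:
  fixes G :: "('i::finite, 's, 'a) csgame"
  assumes data: "game_data G"
    and opt: "\<And>y. primal_feasible G x i y \<Longrightarrow> V \<le> response_value G x i (cost G i) y"
  shows "\<exists>v u d. dual_feasible G x i v u d \<and> dual_value G i v d = V"
proof -
  let ?P = "pairs G i" and ?S = "states G i" and ?K = "{1..num_con G i}"
  define \<alpha> :: "(('s \<times> 'a) + 's + nat) \<Rightarrow> ('s \<times> 'a \<Rightarrow> real) \<Rightarrow> real" where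
    "\<alpha> j y = (case j of Inl w \<Rightarrow> - y w
       | Inr (Inl s) \<Rightarrow> net_outflow G i s y
       | Inr (Inr k) \<Rightarrow> response_value G x i (con_cost G i k) y - con_bound G i k * (\<Sum>w\<in>?P. y w))"
    for j y
  define \<gamma> where "\<gamma> y = V * (\<Sum>w\<in>?P. y w) - response_value G x i (cost G i) y" for y
  define J :: "(('s \<times> 'a) + 's + nat) set" where "J = ?P <+> (?S <+> ?K)"
  define E :: "(('s \<times> 'a) + 's + nat) set" where "E = range (Inr \<circ> Inl)"
  have J_iff: "Inl w \<in> J \<longleftrightarrow> w \<in> ?P" "Inr (Inl s) \<in> J \<longleftrightarrow> s \<in> ?S" "Inr (Inr k) \<in> J \<longleftrightarrow> k \<in> ?K" for w s k
    by (auto simp: J_def)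
  have lin_flow: "net_outflow G i s (\<lambda>w. y w + c * y' w) = net_outflow G i s y + c * net_outflow G i s y'"
    for s y c y'
    by (simp add: net_outflow_def case_prod_unfold algebra_simps sum.distrib
        sum_distrib_left sum_subtractf)
  have lin_resp: "response_value G x i r (\<lambda>w. y w + c * y' w) = response_value G x i r y
      + c * response_value G x i r y'" for r y c y'
    by (simp add: response_value_def algebra_simps sum.distrib sum_distrib_left)
  have lin_sum: "(\<Sum>w\<in>?P. y w + c * y' w) = (\<Sum>w\<in>?P. y w) + c * (\<Sum>w\<in>?P. y' w)"
    for y y' :: "'s \<times> 'a \<Rightarrow> real" and c
    by (simp add: sum.distrib sum_distrib_left)
  have fin: "finite ?P" "finite ?S" using finite_pairs[OF data] game_dataD(1)[OF data] by auto
  have "\<exists>l. (\<forall>j\<in>J - E. 0 \<le> l j) \<and> (\<forall>y. \<gamma> y = (\<Sum>j\<in>J. l j * \<alpha> j y))"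
  proof (rule farkas)
    show "finite J" using fin by (simp add: J_def)
    show "linear_form (\<alpha> j)" for j
      unfolding linear_form_def \<alpha>_def
      by (auto split: sum.split simp: lin_flow lin_resp lin_sum algebra_simps)
    show "linear_form \<gamma>"
      unfolding linear_form_def \<gamma>_def by (auto simp: lin_resp lin_sum algebra_simps)
    fix y
    assume le: "\<And>j. j \<in> J \<Longrightarrow> \<alpha> j y \<le> 0" and eq: "\<And>j. j \<in> J \<inter> E \<Longrightarrow> \<alpha> j y = 0"
    define m where "m = (\<Sum>w\<in>?P. y w)"
    have nonneg: "0 \<le> y w" if "w \<in> ?P" for w
      using le[of "Inl w"] that by (simp add: \<alpha>_def J_iff)
    have flow: "net_outflow G i s y = 0" if "s \<in> ?S" for s
      using eq[of "Inr (Inl s)"] that by (simp add: \<alpha>_def J_iff E_def)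
    have con: "response_value G x i (con_cost G i k) y \<le> con_bound G i k * m" if "k \<in> ?K" for k
      using le[of "Inr (Inr k)"] that by (simp add: \<alpha>_def J_iff m_def)
    show "\<gamma> y \<le> 0"
    proof (cases "m = 0")
      case True
      then have "\<forall>w\<in>?P. y w = 0" using nonneg fin by (simp add: m_def sum_nonneg_eq_0_iff)
      then show ?thesis by (simp add: \<gamma>_def response_value_def)
    next
      case False
      then have m: "m > 0" using nonneg by (simp add: m_def order_less_le sum_nonneg)
      have resp: "response_value G x i r (\<lambda>w. y w / m) = response_value G x i r y / m" for r
        by (simp add: response_value_def sum_divide_distrib)
      have "primal_feasible G x i (\<lambda>w. y w / m)"
        unfolding primal_feasible_def occupation_def
      proof (intro conjI ballI)
        show "net_outflow G i s (\<lambda>w. y w / m) = 0" if "s \<in> ?S" for s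
        proof -
          have "net_outflow G i s (\<lambda>w. y w / m) = net_outflow G i s y / m"
            by (simp add: net_outflow_def case_prod_unfold sum_divide_distrib)
          then show ?thesis using flow[OF that] by simp
        qed
        show "(\<Sum>w\<in>?P. y w / m) = 1" using False by (simp add: m_def flip: sum_divide_distrib)
        show "0 \<le> y w / m" if "w \<in> ?P" for w using nonneg[OF that] m by simp
        show "response_value G x i (con_cost G i k) (\<lambda>w. y w / m) \<le> con_bound G i k" if "k \<in> ?K" for k
          using con[OF that] m by (simp add: resp pos_divide_le_eq)
      qed
      then have "V \<le> response_value G x i (cost G i) y / m" using opt resp by metis
      then show ?thesis using m by (simp add: \<gamma>_def pos_le_divide_eq flip: m_def)
    qed
  qed
  then obtain l where l: "\<And>j. j \<in> J - E \<Longrightarrow> 0 \<le> l j" and combo: "\<And>y. \<gamma> y = (\<Sum>j\<in>J. l j * \<alpha> j y)"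
    by blast
  define u where "u s = - l (Inr (Inl s))" for s
  define d where "d k = l (Inr (Inr k))" for k
  define v where "v = V + (\<Sum>k\<in>?K. d k * con_bound G i k)"
  have "dual_feasible G x i v u d"
    unfolding dual_feasible_def
  proof (intro conjI ballI)
    show "0 \<le> d k" if "k \<in> ?K" for k
      using l[of "Inr (Inr k)"] that by (auto simp: d_def J_iff E_def)
    fix s a
    assume s: "s \<in> ?S" and a: "a \<in> acts G i s"
    then have w: "(s, a) \<in> ?P" by (simp add: pairs_def)
    let ?e = "\<lambda>w. of_bool (w = (s, a)) :: real"
    have sum_e: "(\<Sum>w\<in>?P. F w * ?e w) = F (s, a)" for F :: "'s \<times> 'a \<Rightarrow> real"
      using w fin by (simp add: of_bool_def if_distrib cong: if_cong)
    have mass_e: "(\<Sum>w\<in>?P. ?e w) = 1" using sum_e[of "\<lambda>_. 1"] by simp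
    have flow_e: "net_outflow G i s' ?e = of_bool (s = s') - pmf (kernel G i s a) s'" for s'
      unfolding net_outflow_def
      using sum_e[of "\<lambda>w. of_bool (fst w = s') - pmf (kernel G i (fst w) (snd w)) s'"]
      by (simp only: case_prod_unfold fst_conv snd_conv prod.collapse)
    have nonneg_l: "0 \<le> l (Inl (s, a))" using w by (intro l) (auto simp: J_iff E_def)
    have "\<gamma> ?e = (\<Sum>w\<in>?P. l (Inl w) * \<alpha> (Inl w) ?e)
      + ((\<Sum>s'\<in>?S. l (Inr (Inl s')) * \<alpha> (Inr (Inl s')) ?e)
      + (\<Sum>k\<in>?K. l (Inr (Inr k)) * \<alpha> (Inr (Inr k)) ?e))"
      unfolding combo J_def using fin by (simp add: sum.Plus)
    also have "(\<Sum>w\<in>?P. l (Inl w) * \<alpha> (Inl w) ?e) = - l (Inl (s, a))"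
      using sum_e[of "\<lambda>w. - l (Inl w)"] by (simp add: \<alpha>_def)
    also have "(\<Sum>s'\<in>?S. l (Inr (Inl s')) * \<alpha> (Inr (Inl s')) ?e)
      = - u s + (\<Sum>s'\<in>?S. pmf (kernel G i s a) s' * u s')"
    proof -
      have "(\<Sum>s'\<in>?S. l (Inr (Inl s')) * \<alpha> (Inr (Inl s')) ?e)
        = (\<Sum>s'\<in>?S. (if s = s' then - u s' else 0) + pmf (kernel G i s a) s' * u s')"
        by (intro sum.cong) (auto simp: \<alpha>_def flow_e u_def algebra_simps)
      then show ?thesis using s fin by (simp add: sum.distrib)
    qed
    also have "(\<Sum>k\<in>?K. l (Inr (Inr k)) * \<alpha> (Inr (Inr k)) ?e)
      = (\<Sum>k\<in>?K. d k * other_sum G x i (con_cost G i k) (s, a)) - (\<Sum>k\<in>?K. d k * con_bound G i k)"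
      by (simp add: \<alpha>_def d_def mass_e response_value_indicator[OF data w]
          right_diff_distrib sum_subtractf)
    also have "\<gamma> ?e = V - other_sum G x i (cost G i) (s, a)"
      by (simp add: \<gamma>_def mass_e response_value_indicator[OF data w])
    finally show "v + u s \<le> other_sum G x i (cost G i) (s, a)
          + (\<Sum>k = 1..num_con G i. d k * other_sum G x i (con_cost G i k) (s, a))
          + (\<Sum>s'\<in>?S. pmf (kernel G i s a) s' * u s')"
      using nonneg_l by (simp add: v_def)
  qed
  moreover have "dual_value G i v d = V" by (simp add: dual_value_def v_def)
  ultimately show ?thesis by blast
qed


section \<open>Equilibria as zeros of the program\<close>

lemma mp3_feasible_iff:
  "mp3_feasible G z \<longleftrightarrow> (\<forall>i. primal_feasible G (x_of z) i (x_of z i) \<and>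
     dual_feasible G (x_of z) i (v_of z i) (u_of z i) (delta_of z i))"
proof -
  have "(\<forall>s\<in>states G i. \<forall>a\<in>acts G i s. 0 \<le> x_of z i (s, a)) \<longleftrightarrow> (\<forall>w\<in>pairs G i. 0 \<le> x_of z i w)" for i
    by (auto simp: pairs_def)
  then show ?thesis
    unfolding mp3_feasible_def primal_feasible_def dual_feasible_def occupation_def net_outflow_def
      joint_sum_split[symmetric] by (auto simp: case_prod_unfold)
qed

lemma psi_gaps:
  "psi G z = (\<Sum>i\<in>UNIV. response_value G (x_of z) i (cost G i) (x_of z i)
     - dual_value G i (v_of z i) (delta_of z i))"
  by (simp add: psi_def dual_value_def joint_sum_split[symmetric])

lemma gap_nonneg:
  assumes "game_data G" and "mp3_feasible G z"
  shows "0 \<le> response_value G (x_of z) i (cost G i) (x_of z i)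
    - dual_value G i (v_of z i) (delta_of z i)"
  using weak_duality[OF assms(1)] assms(2) unfolding mp3_feasible_iff by fastforce

text \<open>
  Hence every feasible zero of \<open>psi\<close> is a global minimum.
\<close>

lemma psi_nonneg:
  assumes "game_data G" and "mp3_feasible G z"
  shows "0 \<le> psi G z"
  unfolding psi_gaps using gap_nonneg[OF assms] by (intro sum_nonneg)

context ergodic_game
begin

definition best_response :: "('i \<Rightarrow> 's \<times> 'a \<Rightarrow> real) \<Rightarrow> 'i \<Rightarrow> bool" where
  "best_response x i \<longleftrightarrow> primal_feasible G x i (x i) \<and>
     (\<forall>y. primal_feasible G x i y \<longrightarrow>
        response_value G x i (cost G i) (x i) \<le> response_value G x i (cost G i) y)"

lemma best_response_cong:
  assumes "\<And>j w. w \<in> pairs G j \<Longrightarrow> x j w = x' j w" and "best_response x i"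
  shows "best_response x' i"
  using assms(2) primal_feasible_cong[of G x x' i, OF assms(1)]
    response_value_cong[of i G x x', OF assms(1)] assms(1)
  unfolding best_response_def by metis

text \<open>
  Deviations range over strategies, competitors in the linear program over vectors. Each vector
  satisfying the constraints has the frequencies of some strategy, so the two kinds of optimality
  agree.
\<close>

lemma nash_iff_best_responses:
  assumes f: "stationary_multi G f"
  shows "nash_equilibrium G f \<longleftrightarrow> (\<forall>i. best_response (\<lambda>j. freq G j (f j)) i)"
proof -
  define X where "X = (\<lambda>j. freq G j (f j))"
  have fi: "is_stationary G i (f i)" for i using f by (simp add: stationary_multi_def)
  have own: "avg_cost G r (use_always f) = ereal (response_value G X i r (X i))" for r i
    using avg_cost_stationary[OF f] joint_sum_split by (simp add: X_def)
  have dev: "avg_cost G r (use_always (f(i := g))) = ereal (response_value G X i r (freq G i g))"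
    if g: "is_stationary G i g" for i g r
  proof -
    have "stationary_multi G (f(i := g))" using f g by (simp add: stationary_multi_def)
    moreover have "(\<lambda>j. freq G j ((f(i := g)) j)) = X(i := freq G i g)" by (auto simp: X_def)
    ultimately show ?thesis using avg_cost_stationary[of "f(i := g)"] joint_sum_update by metis
  qed
  have own_con: "D_ea G i k (use_always f) \<le> ereal b \<longleftrightarrow> response_value G X i (con_cost G i k) (X i) \<le> b"
    for i k b
    unfolding D_ea_def own[of _ i] by simp
  have "occupation G i (X i)" for i
    unfolding X_def by (rule occupation_freq[OF fi])
  then have feas: "feasible G (use_always f) \<longleftrightarrow> (\<forall>i. primal_feasible G X i (X i))"
    unfolding feasible_def i_feasible_def own_con primal_feasible_def by blast
  have i_feas: "i_feasible G i (use_always (f(i := g))) \<longleftrightarrow> primal_feasible G X i (freq G i g)"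
    if "is_stationary G i g" for i g
    unfolding i_feasible_def D_ea_def primal_feasible_def
    using dev[OF that] occupation_freq[OF that] by auto
  have cost: "C_ea G i (use_always f) \<le> C_ea G i (use_always (f(i := g))) \<longleftrightarrow>
    response_value G X i (cost G i) (X i) \<le> response_value G X i (cost G i) (freq G i g)"
    if "is_stationary G i g" for i g
    unfolding C_ea_def dev[OF that] using own[of _ i] by simp
  have cover: "\<exists>g. is_stationary G i g \<and> primal_feasible G X i (freq G i g) \<and>
      response_value G X i (cost G i) (freq G i g) = response_value G X i (cost G i) y"
    if y: "primal_feasible G X i y" for i y
  proof -
    have occ: "occupation G i y" using y by (simp add: primal_feasible_def)
    obtain g where g: "is_stationary G i g" "reads_off i y g" using reads_off_exists[OF occ] by blast
    have "\<And>w. w \<in> pairs G i \<Longrightarrow> freq G i g w = y w" using freq_of_reads_off[OF g(1) occ g(2)] .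
    then show ?thesis
      using g(1) y primal_feasible_cong[of G X X i "freq G i g" y]
        response_value_cong[of i G X X "freq G i g" y] by auto
  qed
  have "nash_equilibrium G f \<longleftrightarrow> (\<forall>i. primal_feasible G X i (X i)) \<and>
    (\<forall>i g. is_stationary G i g \<and> primal_feasible G X i (freq G i g) \<longrightarrow>
      response_value G X i (cost G i) (X i) \<le> response_value G X i (cost G i) (freq G i g))"
    unfolding nash_equilibrium_def using f feas i_feas cost by blast
  also have "\<dots> \<longleftrightarrow> (\<forall>i. best_response X i)"
    unfolding best_response_def using cover by metis
  finally show ?thesis by (simp add: X_def)
qed

lemma nash_imp_zero:
  assumes nash: "nash_equilibrium G f"
  shows "\<exists>z. mp3_global_min G z \<and> psi G z = 0"
proof -
  define X where "X = (\<lambda>j. freq G j (f j))"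
  have f: "stationary_multi G f" using nash by (simp add: nash_equilibrium_def)
  have best: "best_response X i" for i using nash nash_iff_best_responses[OF f] by (simp add: X_def)
  have "\<exists>v u d. dual_feasible G X i v u d \<and>
      dual_value G i v d = response_value G X i (cost G i) (X i)" for i
    using best[of i] by (intro strong_duality data) (simp add: best_response_def)
  then obtain v u d where vud: "\<And>i. dual_feasible G X i (v i) (u i) (d i)"
    "\<And>i. dual_value G i (v i) (d i) = response_value G X i (cost G i) (X i)" by metis
  define z where "z = \<lparr>v_of = v, u_of = u, x_of = X, delta_of = d\<rparr>"
  have "mp3_feasible G z"
    using vud(1) best by (simp add: mp3_feasible_iff z_def best_response_def)
  moreover have "psi G z = 0" using vud(2) by (simp add: psi_gaps z_def)
  ultimately show ?thesis
    using psi_nonneg[OF data] by (auto simp: mp3_global_min_def)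
qed

lemma induced_multi_iff:
  "f \<in> induced_multi G z \<longleftrightarrow> stationary_multi G f \<and> (\<forall>i. reads_off i (x_of z i) (f i))"
  by (simp add: induced_multi_def reads_off_def)

lemma zero_imp_nash:
  assumes z: "mp3_feasible G z" "psi G z = 0" and f: "f \<in> induced_multi G z"
  shows "nash_equilibrium G f"
proof -
  let ?x = "x_of z"
  have gap: "response_value G ?x i (cost G i) (?x i) = dual_value G i (v_of z i) (delta_of z i)" for i
    using z(2) gap_nonneg[OF data z(1)] unfolding psi_gaps
    by (subst (asm) sum_nonneg_eq_0_iff) auto
  have pd: "primal_feasible G ?x i (?x i)"
    "dual_feasible G ?x i (v_of z i) (u_of z i) (delta_of z i)" for i
    using z(1) by (auto simp: mp3_feasible_iff)
  have best: "best_response ?x i" for i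
    unfolding best_response_def gap using pd weak_duality[OF data] by blast
  have st: "stationary_multi G f" and read: "\<And>i. reads_off i (?x i) (f i)"
    using f by (auto simp: induced_multi_iff)
  have "?x j w = freq G j (f j) w" if "w \<in> pairs G j" for j w
    using freq_of_reads_off[of j "f j" "?x j" w] st read[of j] pd(1)[of j] that
    by (simp add: stationary_multi_def primal_feasible_def)
  then show ?thesis
    using nash_iff_best_responses[OF st] best_response_cong[OF _ best] by simp
qed

lemma induced_multi_nonempty:
  assumes "mp3_feasible G z"
  shows "induced_multi G z \<noteq> {}"
proof -
  have "\<exists>g. is_stationary G i g \<and> reads_off i (x_of z i) g" for i
    using assms by (intro reads_off_exists) (simp add: mp3_feasible_iff primal_feasible_def)
  then obtain f where "\<And>i. is_stationary G i (f i) \<and> reads_off i (x_of z i) (f i)" by metis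
  then have "f \<in> induced_multi G z" by (simp add: induced_multi_iff stationary_multi_def)
  then show ?thesis by blast
qed

end

theorem theorem3:
  fixes G :: "('i::finite, 's, 'a) csgame"
  assumes "game_data G"
    and "\<exists>f. stationary_multi G f \<and> feasible G (use_always f)"
    and "ergodicity G"
    and "strong_slater G"
  shows "(\<forall>f. nash_equilibrium G f \<longrightarrow> (\<exists>z. mp3_global_min G z \<and> psi G z = 0)) \<and>
    (\<forall>z. mp3_global_min G z \<and> psi G z = 0 \<longrightarrow>
       induced_multi G z \<noteq> {} \<and> (\<forall>f\<in>induced_multi G z. nash_equilibrium G f))"
proof -
  interpret ergodic_game G using assms(1,3) by unfold_locales
  show ?thesis
    using nash_imp_zero zero_imp_nash induced_multi_nonempty by (auto simp: mp3_global_min_def)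
qed

end
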